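(* Let $\alpha\in[0,1]$. Consider the qubit prepare-transform-measure game described in the context. For every strategy (with arbitrary qubit states of Alice, arbitrary two-outcome qubit POVMs of Charlie and arbitrary shared classical randomness) in which Bob uses only projective measurements and their probabilistic mixtures, i.e. in which each instrument used by Bob is a convex combination of two-outcome qubit instruments each of which is compatible with a PVM, the average success probability $\bar P_{\mathrm{succ}}$ satisfies $\bar P_{\mathrm{succ}}\le \bar P^{\mathrm{PVM}}_{\mathrm{succ}}(\alpha)$, where $$\bar P^{\mathrm{PVM}}_{\mathrm{succ}}(\alpha)=\begin{cases}\frac12+\frac{1-\alpha}{2\sqrt2}, & 0\le\alpha\le 1-\frac{2}{\sqrt7},\\[2pt] \frac12+\frac18\sqrt{4+(1-\alpha)^2}, & 1-\frac{2}{\sqrt7}<\alpha\le\frac13,\\[2pt] \frac12+\frac14\sqrt{1+\alpha^2}, & \frac13<\alpha\le1.\end{cases}$$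
   Context: Let $\mathcal H$ be a complex Hilbert space with $\dim\mathcal H=2$ and $\mathcal L(\mathcal H)$ the linear operators on it. A two-outcome POVM is an ordered pair $(B_0,B_1)$ of positive semidefinite operators in $\mathcal L(\mathcal H)$ with $B_0+B_1=\mathbb 1$; it is a PVM (projective measurement) if $B_i^2=B_i$ for $i=0,1$ (so the trivial pairs $(\mathbb 1,0)$, $(0,\mathbb 1)$ are PVMs). A two-outcome (qubit) instrument is an ordered pair $(\mathcal B_0,\mathcal B_1)$ of completely positive trace-nonincreasing maps $\mathcal L(\mathcal H)\to\mathcal L(\mathcal H)$ whose sum $\mathcal B_0+\mathcal B_1$ is trace preserving. It is compatible with the POVM $(B_0,B_1)$ if $\mathrm{tr}(\varrho B_b)=\mathrm{tr}(\mathcal B_b(\varrho))$ for all states $\varrho$ and $b=0,1$. Convex combinations of instruments are taken outcome by outcome. The game: Alice receives $\vec x=(x_0,x_1)\in\{0,1\}^2$, Bob receives $y\in\{0,1\}$, Charlie receives $z\in\{0,1\}$; all bits are independent and uniformly distributed. Without shared randomness, a strategy consists of qubit density operators $\varrho_{\vec x}$ for $\vec x\in\{0,1\}^2$ (prepared by Alice and sent to Bob), instruments $(\mathcal B^y_0,\mathcal B^y_1)$ for $y=0,1$ (applied by Bob, who outputs $b$ and sends the resulting qubit to Charlie), and two-outcome POVMs $(C^z_0,C^z_1)$ for $z=0,1$ (measured by Charlie, who outputs $c$), giving $$p(b,c|\vec x,y,z)=\mathrm{tr}\big(\mathcal B^y_b(\varrho_{\vec x})\,C^z_c\big).$$ The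 parties share no entanglement but may share arbitrary classical randomness: a general strategy chooses such a tuple of states, instruments and POVMs according to a shared random variable independent of the inputs, and $p(b,c|\vec x,y,z)$ is the corresponding average. Put $\Pr(b|\vec x,y)=\sum_c p(b,c|\vec x,y,z)$ (independent of $z$) and $\Pr(c|\vec x,z)=\frac12\sum_{y}\sum_b p(b,c|\vec x,y,z)$. For $\alpha\in[0,1]$ the average success probability is $$\bar P_{\mathrm{succ}}=\frac{\alpha}{8}\sum_{\vec x,y}\Pr(b=x_y|\vec x,y)+\frac{1-\alpha}{8}\sum_{\vec x,z}\Pr(c=x_z|\vec x,z).$$ *)

theory Defs
  imports "HOL-Probability.Probability"
begin

text \<open>
  Every two-dimensional complex Hilbert space is unitarily equivalent to \<open>complex^2\<close> with its
  standard inner product, so operators on it are complex 2-by-2 matrices. Bits are Booleans, with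
  \<open>False\<close> for 0 and \<open>True\<close> for 1; an ordered pair indexed by a bit is a function on \<open>bool\<close>.
\<close>

type_synonym qop = "complex^2^2"

definition cinner :: "complex^'n \<Rightarrow> complex^'n \<Rightarrow> complex" where
  "cinner u v = (\<Sum>i\<in>UNIV. cnj (u $ i) * v $ i)"

definition cscale :: "complex \<Rightarrow> complex^'n^'m \<Rightarrow> complex^'n^'m" where
  "cscale c A = (\<chi> i j. c * A $ i $ j)"

definition psd :: "complex^'n^'n \<Rightarrow> bool" where
  "psd A \<longleftrightarrow> (\<forall>v. cinner v (A *v v) \<in> \<real>\<^sub>\<ge>\<^sub>0)"

definition density :: "qop \<Rightarrow> bool" where
  "density \<rho> \<longleftrightarrow> psd \<rho> \<and> trace \<rho> = 1"

definition povm :: "(bool \<Rightarrow> qop) \<Rightarrow> bool" where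
  "povm E \<longleftrightarrow> (\<forall>b. psd (E b)) \<and> E False + E True = mat 1"

definition pvm :: "(bool \<Rightarrow> qop) \<Rightarrow> bool" where
  "pvm E \<longleftrightarrow> povm E \<and> (\<forall>b. E b ** E b = E b)"

text \<open>
  \<open>block_psd n X\<close>: the n-by-n block matrix with blocks \<open>X i j\<close> (for \<open>i, j < n\<close>) is positive
  semidefinite as an operator on the n-fold direct sum of \<open>complex^2\<close>, that is, on the tensor
  product of the n-dimensional space with \<open>complex^2\<close>. Applying \<open>\<Phi>\<close> to every block is the
  tensor product of the identity map on n-by-n matrices with \<open>\<Phi>\<close>.
\<close>

definition block_psd :: "nat \<Rightarrow> (nat \<Rightarrow> nat \<Rightarrow> qop) \<Rightarrow> bool" where
  "block_psd n X \<longleftrightarrow>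
     (\<forall>v :: nat \<Rightarrow> complex^2. (\<Sum>i<n. \<Sum>j<n. cinner (v i) (X i j *v v j)) \<in> \<real>\<^sub>\<ge>\<^sub>0)"

definition completely_positive :: "(qop \<Rightarrow> qop) \<Rightarrow> bool" where
  "completely_positive \<Phi> \<longleftrightarrow>
     Vector_Spaces.linear cscale cscale \<Phi> \<and>
     (\<forall>n X. block_psd n X \<longrightarrow> block_psd n (\<lambda>i j. \<Phi> (X i j)))"

definition trace_nonincreasing :: "(qop \<Rightarrow> qop) \<Rightarrow> bool" where
  "trace_nonincreasing \<Phi> \<longleftrightarrow> (\<forall>X. psd X \<longrightarrow> Re (trace (\<Phi> X)) \<le> Re (trace X))"

definition instrument :: "(bool \<Rightarrow> qop \<Rightarrow> qop) \<Rightarrow> bool" where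
  "instrument B \<longleftrightarrow>
     (\<forall>b. completely_positive (B b) \<and> trace_nonincreasing (B b)) \<and>
     (\<forall>X. trace (B False X + B True X) = trace X)"

definition compatible :: "(bool \<Rightarrow> qop \<Rightarrow> qop) \<Rightarrow> (bool \<Rightarrow> qop) \<Rightarrow> bool" where
  "compatible B E \<longleftrightarrow> (\<forall>\<rho> b. density \<rho> \<longrightarrow> trace (\<rho> ** E b) = trace (B b \<rho>))"

definition projective_mixture :: "(bool \<Rightarrow> qop \<Rightarrow> qop) \<Rightarrow> bool" where
  "projective_mixture B \<longleftrightarrow>
     (\<exists>(n::nat) (w :: nat \<Rightarrow> real) I.
        (\<forall>k<n. 0 \<le> w k) \<and> (\<Sum>k<n. w k) = 1 \<and>
        (\<forall>k<n. instrument (I k) \<and> (\<exists>E. pvm E \<and> compatible (I k) E)) \<and>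
        (\<forall>b X. B b X = (\<Sum>k<n. w k *\<^sub>R I k b X)))"

text \<open>
  Alice's input is a function \<open>x\<close> on \<open>bool\<close>, so that the two bits are \<open>x False\<close> and \<open>x True\<close>.
  In \<open>instr S y b\<close> and \<open>meas S z c\<close> the first argument is the input and the second the outcome.
\<close>

record strategy =
  prep :: "(bool \<Rightarrow> bool) \<Rightarrow> qop"
  instr :: "bool \<Rightarrow> bool \<Rightarrow> qop \<Rightarrow> qop"
  meas :: "bool \<Rightarrow> bool \<Rightarrow> qop"

definition valid_strategy :: "strategy \<Rightarrow> bool" where
  "valid_strategy S \<longleftrightarrow>
     (\<forall>x. density (prep S x)) \<and> (\<forall>y. instrument (instr S y)) \<and> (\<forall>z. povm (meas S z))"

type_synonym behaviour = "bool \<Rightarrow> bool \<Rightarrow> (bool \<Rightarrow> bool) \<Rightarrow> bool \<Rightarrow> bool \<Rightarrow> real"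

text \<open>The trace below is a nonnegative real number for valid strategies.\<close>

definition pure_behaviour :: "strategy \<Rightarrow> behaviour" where
  "pure_behaviour S b c x y z = Re (trace (instr S y b (prep S x) ** meas S z c))"

text \<open>
  A strategy with shared randomness is a family of strategies indexed by the points of a
  probability space \<open>M\<close>. The measurability condition concerns only the resulting probabilities;
  it holds whenever the states, instruments and POVMs themselves depend measurably on the point.
\<close>

definition shared_randomness_strategy :: "'r measure \<Rightarrow> ('r \<Rightarrow> strategy) \<Rightarrow> bool" where
  "shared_randomness_strategy M S \<longleftrightarrow>
     prob_space M \<and> (\<forall>r\<in>space M. valid_strategy (S r)) \<and>
     (\<forall>b c x y z. (\<lambda>r. pure_behaviour (S r) b c x y z) \<in> borel_measurable M)"

definition behaviour_of :: "'r measure \<Rightarrow> ('r \<Rightarrow> strategy) \<Rightarrow> behaviour" where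
  "behaviour_of M S b c x y z = (\<integral>r. pure_behaviour (S r) b c x y z \<partial>M)"

text \<open>
  The marginal of Bob's outcome does not depend on Charlie's input (see \<open>bob_marginal\<close> below);
  the definition uses input 0.
\<close>

definition prob_bob :: "behaviour \<Rightarrow> bool \<Rightarrow> (bool \<Rightarrow> bool) \<Rightarrow> bool \<Rightarrow> real" where
  "prob_bob p b x y = (\<Sum>c\<in>UNIV. p b c x y False)"

definition prob_charlie :: "behaviour \<Rightarrow> bool \<Rightarrow> (bool \<Rightarrow> bool) \<Rightarrow> bool \<Rightarrow> real" where
  "prob_charlie p c x z = 1/2 * (\<Sum>y\<in>UNIV. \<Sum>b\<in>UNIV. p b c x y z)"

definition avg_success :: "real \<Rightarrow> behaviour \<Rightarrow> real" where
  "avg_success \<alpha> p =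
     \<alpha> / 8 * (\<Sum>x\<in>UNIV. \<Sum>y\<in>UNIV. prob_bob p (x y) x y) +
     (1 - \<alpha>) / 8 * (\<Sum>x\<in>UNIV. \<Sum>z\<in>UNIV. prob_charlie p (x z) x z)"

definition pvm_bound :: "real \<Rightarrow> real" where
  "pvm_bound \<alpha> =
     (if \<alpha> \<le> 1 - 2 / sqrt 7 then 1/2 + (1 - \<alpha>) / (2 * sqrt 2)
      else if \<alpha> \<le> 1/3 then 1/2 + 1/8 * sqrt (4 + (1 - \<alpha>)\<^sup>2)
      else 1/2 + 1/4 * sqrt (1 + \<alpha>\<^sup>2))"

text \<open>Hence the linearity requirement in \<open>completely_positive\<close> is ordinary complex linearity.\<close>

lemma vector_space_cscale: "vector_space cscale"
  by unfold_locales (auto simp: cscale_def vec_eq_iff algebra_simps)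

lemma psd_2:
  fixes A :: qop
  assumes "psd A"
  obtains a d :: real and z where "0 \<le> a" "0 \<le> d" "(cmod z)\<^sup>2 \<le> a * d"
    "A $ 1 $ 1 = of_real a" "A $ 2 $ 2 = of_real d" "A $ 1 $ 2 = z" "A $ 2 $ 1 = cnj z"
proof -
  have q: "cnj u * (A$1$1 * u + A$1$2 * v) + cnj v * (A$2$1 * u + A$2$2 * v) \<in> \<real>\<^sub>\<ge>\<^sub>0" for u v
    using assms[unfolded psd_def, rule_format, of "vector [u, v]"]
    by (simp add: cinner_def matrix_vector_mult_def sum_2)
  define a d z where "a = Re (A$1$1)" and "d = Re (A$2$2)" and "z = A$1$2"
  have a: "A$1$1 = of_real a" "0 \<le> a" using q[of 1 0]
    by (auto simp: complex_nonneg_Reals_iff a_def complex_eq_iff)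
  have d: "A$2$2 = of_real d" "0 \<le> d" using q[of 0 1]
    by (auto simp: complex_nonneg_Reals_iff d_def complex_eq_iff)
  have z: "A$2$1 = cnj z" using q[of 1 1] q[of 1 \<i>]
    by (auto simp: complex_nonneg_Reals_iff complex_eq_iff a d z_def)
  have "(cmod z)\<^sup>2 \<le> a * d"
  proof -
    have r: "0 \<le> Re (cnj u * (of_real a * u + z * v) + cnj v * (cnj z * u + of_real d * v))" for u v
      using q[of u v] by (simp add: a d z z_def complex_nonneg_Reals_iff)
    show ?thesis
    proof (cases "d = 0")
      case False
      have "0 \<le> d * (a * d - (cmod z)\<^sup>2)"
        using r[of "of_real d" "- cnj z"] unfolding cmod_power2
        by (simp add: power2_eq_square algebra_simps)
      then show ?thesis using False d(2) by (simp add: zero_le_mult_iff)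
    next
      case True
      have "0 \<le> a - 2 * t * (cmod z)\<^sup>2" for t :: real
        using r[of 1 "- of_real t * cnj z"] True unfolding cmod_power2
        by (simp add: power2_eq_square algebra_simps)
      from this[of "(a + 1) / (2 * (cmod z)\<^sup>2)"] True show ?thesis
        by (cases "z = 0") auto
    qed
  qed
  then show ?thesis using that a d z z_def by blast
qed

lemma trace_psd_mult_nonneg:
  fixes A C :: qop
  assumes "psd A" "psd C"
  shows "trace (A ** C) \<in> \<real>\<^sub>\<ge>\<^sub>0"
proof -
  obtain a d z where A: "0 \<le> a" "0 \<le> d" "(cmod z)\<^sup>2 \<le> a * d"
    "A $ 1 $ 1 = of_real a" "A $ 2 $ 2 = of_real d" "A $ 1 $ 2 = z" "A $ 2 $ 1 = cnj z"
    using psd_2[OF assms(1)] .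
  obtain e g f where C: "0 \<le> e" "0 \<le> g" "(cmod f)\<^sup>2 \<le> e * g"
    "C $ 1 $ 1 = of_real e" "C $ 2 $ 2 = of_real g" "C $ 1 $ 2 = f" "C $ 2 $ 1 = cnj f"
    using psd_2[OF assms(2)] .
  have "\<bar>2 * Re (z * cnj f)\<bar> \<le> 2 * (cmod z * cmod f)"
    using abs_Re_le_cmod[of "z * cnj f"] by (simp add: norm_mult)
  moreover have "2 * (cmod z * cmod f) \<le> a * e + d * g"
  proof (rule power2_le_imp_le)
    have "(2 * (cmod z * cmod f))\<^sup>2 = 4 * ((cmod z)\<^sup>2 * (cmod f)\<^sup>2)"
      by (simp add: power_mult_distrib)
    also have "\<dots> \<le> 4 * ((a * d) * (e * g))"
      using A C by (intro mult_left_mono mult_mono) auto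
    also have "\<dots> \<le> (a * e + d * g)\<^sup>2"
      using zero_le_power2[of "a * e - d * g"] by (simp add: power2_eq_square algebra_simps)
    finally show "(2 * (cmod z * cmod f))\<^sup>2 \<le> (a * e + d * g)\<^sup>2" .
  qed (use A C in auto)
  moreover have "trace (A ** C) = of_real (a * e + d * g + 2 * Re (z * cnj f))"
    by (simp add: trace_def matrix_matrix_mult_def sum_2 A C complex_eq_iff algebra_simps)
  ultimately show ?thesis by (simp only: nonneg_Reals_of_real_iff)
qed

lemma completely_positive_psd:
  assumes "completely_positive \<Phi>" "psd A"
  shows "psd (\<Phi> A)"
proof -
  have "block_psd 1 (\<lambda>i j. A)" using assms(2) by (simp add: psd_def block_psd_def)
  then have "block_psd 1 (\<lambda>i j. \<Phi> A)" using assms(1) unfolding completely_positive_def by blast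
  then show ?thesis unfolding psd_def block_psd_def by (auto dest: spec[of _ "\<lambda>_. v" for v])
qed

lemma pure_behaviour_real_nonneg:
  assumes "valid_strategy S"
  shows "trace (instr S y b (prep S x) ** meas S z c) \<in> \<real>\<^sub>\<ge>\<^sub>0"
  using assms unfolding valid_strategy_def instrument_def povm_def density_def
  by (blast intro: trace_psd_mult_nonneg completely_positive_psd)

lemma pure_bob_marginal:
  assumes "valid_strategy S"
  shows "(\<Sum>c\<in>UNIV. pure_behaviour S b c x y z) = Re (trace (instr S y b (prep S x)))"
proof -
  have "meas S z False + meas S z True = mat 1"
    using assms unfolding valid_strategy_def povm_def by blast
  then show ?thesis
    by (simp add: pure_behaviour_def UNIV_bool add.commute flip: plus_complex.simps trace_add
        matrix_add_ldistrib)
qed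

lemma pure_behaviour_bounds:
  assumes "valid_strategy S"
  shows "0 \<le> pure_behaviour S b c x y z" "pure_behaviour S b c x y z \<le> 1"
proof -
  have nn: "0 \<le> pure_behaviour S b c x y z" for c
    using pure_behaviour_real_nonneg[OF assms]
    by (simp add: pure_behaviour_def complex_nonneg_Reals_iff)
  then show "0 \<le> pure_behaviour S b c x y z" .
  have "pure_behaviour S b c x y z \<le> (\<Sum>c\<in>UNIV. pure_behaviour S b c x y z)"
    by (rule member_le_sum) (use nn in auto)
  also have "\<dots> = Re (trace (instr S y b (prep S x)))" by (rule pure_bob_marginal[OF assms])
  also have "\<dots> \<le> Re (trace (prep S x))"
    using assms unfolding valid_strategy_def instrument_def trace_nonincreasing_def density_def
    by blast
  also have "\<dots> = 1" using assms unfolding valid_strategy_def density_def by simp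
  finally show "pure_behaviour S b c x y z \<le> 1" .
qed

lemma integrable_pure_behaviour:
  assumes "shared_randomness_strategy M S"
  shows "integrable M (\<lambda>r. pure_behaviour (S r) b c x y z)"
proof -
  interpret prob_space M using assms unfolding shared_randomness_strategy_def by blast
  show ?thesis
  proof (rule integrable_const_bound[where B = 1])
    show "AE r in M. norm (pure_behaviour (S r) b c x y z) \<le> 1"
      using assms pure_behaviour_bounds unfolding shared_randomness_strategy_def
      by (intro AE_I2) auto
  qed (use assms in \<open>auto simp: shared_randomness_strategy_def\<close>)
qed

lemma bob_marginal:
  assumes "shared_randomness_strategy M S"
  shows "(\<Sum>c\<in>UNIV. behaviour_of M S b c x y z) = prob_bob (behaviour_of M S) b x y"
proof -
  have "(\<Sum>c\<in>UNIV. behaviour_of M S b c x y z) =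
      (\<integral>r. Re (trace (instr (S r) y b (prep (S r) x))) \<partial>M)" for z
  proof -
    have "(\<Sum>c\<in>UNIV. behaviour_of M S b c x y z) =
        (\<integral>r. (\<Sum>c\<in>UNIV. pure_behaviour (S r) b c x y z) \<partial>M)"
      unfolding behaviour_of_def
      by (rule Bochner_Integration.integral_sum[symmetric])
        (rule integrable_pure_behaviour[OF assms])
    also have "\<dots> = (\<integral>r. Re (trace (instr (S r) y b (prep (S r) x))) \<partial>M)"
      by (rule Bochner_Integration.integral_cong)
        (use assms in \<open>auto simp: shared_randomness_strategy_def intro: pure_bob_marginal\<close>)
    finally show ?thesis .
  qed
  then show ?thesis by (simp add: prob_bob_def)
qed

end

theory Submission
  imports Defs
begin

text \<open>
  In Bloch coordinates, pairing complementary inputs of Alice reduces the game to two vectors \<open>u\<close>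
  and \<open>v\<close> of the unit ball: the success probability is \<open>1/2 + gain/8\<close>, where the gain depends on
  Bob's instrument for input \<open>y\<close> only through the linear functional \<open>bias\<close> of his outcome and the
  contraction \<open>bloch_map\<close> of the Bloch ball. The gain is affine in each instrument, so mixtures and
  shared randomness cannot beat the best instruments compatible with a PVM. Such an instrument
  either has an outcome independent of the state (\<open>bias\<close> zero), or measures a rank-one projector
  along a Bloch vector \<open>n\<close>; positivity alone then forces it to measure and prepare, i.e. its Bloch
  map factors through \<open>n\<close>. If both instruments are of the first kind the gain is at most
  \<open>2 sqrt 2 (1 - \<alpha>)\<close>, if exactly one is, at most \<open>sqrt (4 + (1 - \<alpha>)\<^sup>2)\<close>, and otherwise at most
  \<open>2 sqrt (1 + \<alpha>\<^sup>2)\<close>. The bound is the largest of these three.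
\<close>

subsection \<open>Vector inequalities\<close>

text \<open>Cauchy-Schwarz in the plane: by Lagrange's identity the two sides of the squared
  inequality differ by \<open>(s * y - t * x)\<^sup>2\<close>. Each of the three bounds on the gain
  ends with this step.\<close>

lemma sum_le_sqrt_of_squares:
  fixes x y s t k :: real
  assumes "s\<^sup>2 + t\<^sup>2 \<le> m" "x\<^sup>2 + y\<^sup>2 \<le> k"
  shows "s * x + t * y \<le> sqrt (m * k)"
proof (rule real_le_rsqrt)
  have "(s * x + t * y)\<^sup>2 \<le> (s\<^sup>2 + t\<^sup>2) * (x\<^sup>2 + y\<^sup>2)"
    using zero_le_power2[of "s * y - t * x"] by (simp add: power2_eq_square algebra_simps)
  also have "\<dots> \<le> m * k"
    by (rule mult_mono[OF assms]) (use assms(1) sum_power2_ge_zero[of s t] sum_power2_ge_zero[of x y] in linarith)+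
  finally show "(s * x + t * y)\<^sup>2 \<le> m * k" .
qed

lemma parallelogram:
  fixes u v :: "'a::real_inner"
  shows "(norm (u + v))\<^sup>2 + (norm (u - v))\<^sup>2 = 2 * (norm u)\<^sup>2 + 2 * (norm v)\<^sup>2"
  by (simp add: power2_norm_eq_inner inner_add inner_diff inner_commute algebra_simps)

section \<open>The three bounds on the gain\<close>

text \<open>With both biases zero only Charlie's term is left, with
  \<open>\<beta> = 1 - \<alpha>\<close>. Two contractions lengthen a vector at most by the factor 2,
  and the parallelogram law bounds the sum of the lengths of \<open>u + v\<close> and
  \<open>u - v\<close>.\<close>

lemma two_trivial_bound:
  fixes u v :: "'a::real_inner"
  assumes "norm u \<le> 1" "norm v \<le> 1" "0 \<le> \<beta>" "norm c0 \<le> 1" "norm c1 \<le> 1"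
    and T0: "\<And>r. norm (T0 r) \<le> norm r" and T1: "\<And>r. norm (T1 r) \<le> norm r"
  shows "\<beta> / 2 * (c0 \<bullet> (T0 (u + v) + T1 (u + v)) + c1 \<bullet> (T0 (u - v) + T1 (u - v)))
    \<le> 2 * sqrt 2 * \<beta>"
proof -
  have d: "c \<bullet> (T0 r + T1 r) \<le> 2 * norm r" if "norm c \<le> 1" for c r
  proof -
    have "c \<bullet> (T0 r + T1 r) \<le> norm c * norm (T0 r + T1 r)" by (rule norm_cauchy_schwarz)
    also have "\<dots> \<le> norm (T0 r + T1 r)" using that by (intro mult_left_le_one_le) auto
    also have "\<dots> \<le> 2 * norm r" using norm_triangle_ineq[of "T0 r" "T1 r"] T0[of r] T1[of r] by simp
    finally show ?thesis .
  qed
  have "1 * norm (u + v) + 1 * norm (u - v) \<le> sqrt (2 * 4)"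
    using power_le_one[of "norm u" 2] power_le_one[of "norm v" 2] assms(1,2)
    by (intro sum_le_sqrt_of_squares) (auto simp: parallelogram)
  also have "sqrt (2 * 4) = 2 * sqrt 2" by (simp only: real_sqrt_mult real_sqrt_four mult.commute)
  finally have "norm (u + v) + norm (u - v) \<le> 2 * sqrt 2" by simp
  then have "c0 \<bullet> (T0 (u + v) + T1 (u + v)) + c1 \<bullet> (T0 (u - v) + T1 (u - v)) \<le> 4 * sqrt 2"
    using d[OF assms(4), of "u + v"] d[OF assms(5), of "u - v"] by linarith
  from mult_left_mono[OF this, of "\<beta> / 2"] assms(3) show ?thesis by (simp add: mult_ac)
qed

text \<open>Bessel's inequality, from expanding the squared length of the residual of
  \<open>n\<close>. The norms of \<open>P\<close> and \<open>Q\<close> may be less than one, so that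
  zero vectors are covered.\<close>

lemma bessel_pair:
  fixes n P Q :: "'a::real_inner"
  assumes "norm n = 1" "norm P \<le> 1" "norm Q \<le> 1" "P \<bullet> Q = 0"
  shows "(n \<bullet> P)\<^sup>2 + (n \<bullet> Q)\<^sup>2 \<le> 1"
proof -
  let ?x = "n \<bullet> P" and ?y = "n \<bullet> Q"
  have "0 \<le> (norm (n - ?x *\<^sub>R P - ?y *\<^sub>R Q))\<^sup>2" by simp
  also have "\<dots> = 1 - 2 * ?x\<^sup>2 - 2 * ?y\<^sup>2 + ?x\<^sup>2 * (norm P)\<^sup>2 + ?y\<^sup>2 * (norm Q)\<^sup>2"
    using assms(1,4) unfolding norm_eq_1 power2_norm_eq_inner
    by (simp add: inner_diff inner_commute algebra_simps power2_eq_square)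
  also have "\<dots> \<le> 1 - 2 * ?x\<^sup>2 - 2 * ?y\<^sup>2 + ?x\<^sup>2 + ?y\<^sup>2"
    using assms(2,3) by (intro add_mono mult_right_le_one_le) (auto intro: power_le_one)
  finally show ?thesis by simp
qed

text \<open>Here \<open>T\<close> is the Bloch map of the instrument with zero bias,
  \<open>s\<close> the vector prepared by the other one, and \<open>p\<close>, \<open>q\<close>
  stand for \<open>u + v\<close> and \<open>u - v\<close> or the reverse. After \<open>p\<close> and
  \<open>q\<close> are split into lengths and directions, the claim is Cauchy-Schwarz in the two
  lengths, and it remains to bound the two coefficients.\<close>

lemma one_trivial_bound:
  fixes p q :: "'a::real_inner"
  assumes T: "linear T" "\<And>r. norm (T r) \<le> norm r"
    and pq: "p \<bullet> q = 0" "(norm p)\<^sup>2 + (norm q)\<^sup>2 = 4"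
    and n: "norm n = 1" and s: "norm s \<le> 1" and c: "norm c0 \<le> 1" "norm c1 \<le> 1"
    and \<alpha>: "0 \<le> \<alpha>" "\<alpha> \<le> 1"
  shows "\<alpha> * (n \<bullet> q) + (1 - \<alpha>) / 2 * (c0 \<bullet> (T p + (n \<bullet> p) *\<^sub>R s) + c1 \<bullet> (T q + (n \<bullet> q) *\<^sub>R s))
    \<le> sqrt (4 + (1 - \<alpha>)\<^sup>2)"
proof -
  \<comment> \<open>Since \<open>sgn 0 = 0\<close>, the decompositions into length and direction
    also hold for vanishing \<open>p\<close> or \<open>q\<close>.\<close>
  define P Q x y X Y where "P = sgn p" and "Q = sgn q" and "x = n \<bullet> P" and "y = n \<bullet> Q"
    and "X = norm (T P + x *\<^sub>R s)" and "Y = norm (T Q + y *\<^sub>R s)"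
  have p: "p = norm p *\<^sub>R P" and q: "q = norm q *\<^sub>R Q"
    by (cases "p = 0"; simp add: P_def sgn_div_norm) (cases "q = 0"; simp add: Q_def sgn_div_norm)
  have PQ: "norm P \<le> 1" "norm Q \<le> 1" by (auto simp: P_def Q_def norm_sgn)
  have orth: "P \<bullet> Q = 0" using pq(1) by (simp add: P_def Q_def sgn_div_norm)
  have xy: "x\<^sup>2 + y\<^sup>2 \<le> 1" unfolding x_def y_def by (rule bessel_pair[OF n PQ orth])
  have "y\<^sup>2 \<le> 1" using xy zero_le_power2[of x] by linarith
  then have y1: "\<bar>y\<bar> \<le> 1" by (simp add: abs_square_le_1)
  have TPQ: "norm (T P) \<le> 1" "norm (T Q) \<le> 1"
    using T(2)[of P] T(2)[of Q] PQ by linarith+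
  have scaled: "c \<bullet> (T r + (n \<bullet> r) *\<^sub>R s) \<le> norm r * norm (T R + (n \<bullet> R) *\<^sub>R s)"
    if "norm c \<le> 1" "r = norm r *\<^sub>R R" for c r R
  proof -
    have "T r + (n \<bullet> r) *\<^sub>R s = norm r *\<^sub>R (T R + (n \<bullet> R) *\<^sub>R s)"
      by (subst that(2), subst (2) that(2)) (simp add: linear_scale[OF T(1)] scaleR_add_right)
    then have "c \<bullet> (T r + (n \<bullet> r) *\<^sub>R s) = norm r * (c \<bullet> (T R + (n \<bullet> R) *\<^sub>R s))" by simp
    also have "\<dots> \<le> norm r * (norm c * norm (T R + (n \<bullet> R) *\<^sub>R s))"
      by (intro mult_left_mono norm_cauchy_schwarz) auto
    also have "\<dots> \<le> norm r * norm (T R + (n \<bullet> R) *\<^sub>R s)"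
      using that(1) by (intro mult_left_mono mult_left_le_one_le) auto
    finally show ?thesis .
  qed
  have Y2: "Y \<le> 2"
  proof -
    have "Y \<le> norm (T Q) + norm (y *\<^sub>R s)" unfolding Y_def by (rule norm_triangle_ineq)
    also have "\<dots> \<le> 1 + 1"
      using TPQ(2) y1 s by (intro add_mono) (auto intro: mult_le_one)
    finally show ?thesis by simp
  qed
  \<comment> \<open>The bound is 1 + 1 + 1 + 2. By linearity of \<open>T\<close> the two cross terms
    merge into one inner product of \<open>s\<close> with the image of
    \<open>x *\<^sub>R P + y *\<^sub>R Q\<close>, a vector of norm at most one by orthogonality and
    Bessel.\<close>
  have XY: "X\<^sup>2 + Y\<^sup>2 \<le> 5"
  proof -
    have "X\<^sup>2 + Y\<^sup>2 = (norm (T P))\<^sup>2 + (norm (T Q))\<^sup>2 + (x\<^sup>2 + y\<^sup>2) * (norm s)\<^sup>2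
        + 2 * (s \<bullet> T (x *\<^sub>R P + y *\<^sub>R Q))"
      unfolding X_def Y_def power2_norm_eq_inner
      by (simp add: linear_add[OF T(1)] linear_scale[OF T(1)]
          inner_add inner_commute algebra_simps power2_eq_square)
    moreover have "s \<bullet> T (x *\<^sub>R P + y *\<^sub>R Q) \<le> 1"
    proof -
      have "(norm (x *\<^sub>R P + y *\<^sub>R Q))\<^sup>2 = x\<^sup>2 * (norm P)\<^sup>2 + y\<^sup>2 * (norm Q)\<^sup>2"
        using orth unfolding power2_norm_eq_inner by (simp add: inner_add inner_commute power2_eq_square)
      also have "\<dots> \<le> x\<^sup>2 + y\<^sup>2"
        using PQ by (intro add_mono mult_right_le_one_le) (auto intro: power_le_one)
      also have "\<dots> \<le> 1\<^sup>2" using xy by simp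
      finally have "norm (x *\<^sub>R P + y *\<^sub>R Q) \<le> 1" by (rule power2_le_imp_le) simp
      then have "norm (T (x *\<^sub>R P + y *\<^sub>R Q)) \<le> 1" using T(2) order_trans by blast
      then have "norm s * norm (T (x *\<^sub>R P + y *\<^sub>R Q)) \<le> 1" using s by (simp add: mult_le_one)
      then show ?thesis using norm_cauchy_schwarz order_trans by blast
    qed
    moreover have "(norm (T P))\<^sup>2 \<le> 1" "(norm (T Q))\<^sup>2 \<le> 1"
      using TPQ by (auto intro: power_le_one)
    moreover have "(x\<^sup>2 + y\<^sup>2) * (norm s)\<^sup>2 \<le> 1"
      using xy s by (intro mult_le_one power_le_one) auto
    ultimately show ?thesis by linarith
  qed
  have "\<alpha> * (n \<bullet> q) + (1 - \<alpha>) / 2 * (c0 \<bullet> (T p + (n \<bullet> p) *\<^sub>R s) + c1 \<bullet> (T q + (n \<bullet> q) *\<^sub>R s))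
      \<le> \<alpha> * (norm q * y) + (1 - \<alpha>) / 2 * (norm p * X + norm q * Y)"
  proof (rule add_mono)
    show "\<alpha> * (n \<bullet> q) \<le> \<alpha> * (norm q * y)" by (subst q) (simp add: y_def)
    show "(1 - \<alpha>) / 2 * (c0 \<bullet> (T p + (n \<bullet> p) *\<^sub>R s) + c1 \<bullet> (T q + (n \<bullet> q) *\<^sub>R s))
        \<le> (1 - \<alpha>) / 2 * (norm p * X + norm q * Y)"
      using \<alpha> scaled[OF c(1) p] scaled[OF c(2) q] unfolding X_def Y_def x_def y_def
      by (intro mult_left_mono add_mono) auto
  qed
  also have "\<dots> = (norm p / 2) * ((1 - \<alpha>) * X) + (norm q / 2) * (2 * \<alpha> * y + (1 - \<alpha>) * Y)"
    by (simp add: field_simps)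
  also have "\<dots> \<le> sqrt (1 * (4 + (1 - \<alpha>)\<^sup>2))"
  proof (rule sum_le_sqrt_of_squares)
    show "(norm p / 2)\<^sup>2 + (norm q / 2)\<^sup>2 \<le> 1" using pq(2) by (simp add: power_divide)
    \<comment> \<open>All estimates used are equalities at \<open>y = 1\<close>,
      \<open>X = 1\<close>, \<open>Y = 2\<close>, where the left side is
      \<open>4 + (1 - \<alpha>)\<^sup>2\<close>.\<close>
    have "((1 - \<alpha>) * X)\<^sup>2 + (2 * \<alpha> * y + (1 - \<alpha>) * Y)\<^sup>2
        = (1 - \<alpha>)\<^sup>2 * (X\<^sup>2 + Y\<^sup>2) + 4 * \<alpha>\<^sup>2 * y\<^sup>2 + 4 * (\<alpha> * (1 - \<alpha>)) * (y * Y)"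
      by (simp add: power2_eq_square algebra_simps)
    also have "\<dots> \<le> (1 - \<alpha>)\<^sup>2 * 5 + 4 * \<alpha>\<^sup>2 * 1 + 4 * (\<alpha> * (1 - \<alpha>)) * 2"
    proof (intro add_mono mult_left_mono)
      show "y * Y \<le> 2"
        using mult_mono[of y 1 Y 2] y1 Y2 by (simp add: Y_def)
    qed (use XY y1 \<alpha> in \<open>auto simp: abs_square_le_1\<close>)
    also have "\<dots> = 4 + (1 - \<alpha>)\<^sup>2" by (simp add: power2_eq_square algebra_simps)
    finally show "((1 - \<alpha>) * X)\<^sup>2 + (2 * \<alpha> * y + (1 - \<alpha>) * Y)\<^sup>2 \<le> 4 + (1 - \<alpha>)\<^sup>2" .
  qed
  finally show ?thesis by simp
qed

text \<open>Charlie's coefficients, inner products of some \<open>c\<close> with some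
  \<open>s\<close>, lie between -1 and 1. As \<open>\<bar>w + w'\<bar> + \<bar>w - w'\<bar>\<close>
  is twice the larger of \<open>\<bar>w\<bar>\<close> and \<open>\<bar>w'\<bar>\<close>, the gain is
  at most a piecewise linear function of the four overlaps of \<open>u\<close>, \<open>v\<close>
  with \<open>n0\<close>, \<open>n1\<close>, which is then bounded piece by piece.\<close>

lemma no_trivial_bound:
  fixes u v s0 s1 c0 c1 :: "'a::real_inner"
  assumes uv: "norm u \<le> 1" "norm v \<le> 1" and n: "norm n0 = 1" "norm n1 = 1"
    and s: "norm s0 \<le> 1" "norm s1 \<le> 1" and c: "norm c0 \<le> 1" "norm c1 \<le> 1"
    and \<alpha>: "0 \<le> \<alpha>" "\<alpha> \<le> 1"
  shows "\<alpha> * (n0 \<bullet> (u + v) + n1 \<bullet> (u - v)) + (1 - \<alpha>) / 2 *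
      (c0 \<bullet> ((n0 \<bullet> (u + v)) *\<^sub>R s0 + (n1 \<bullet> (u + v)) *\<^sub>R s1)
        + c1 \<bullet> ((n0 \<bullet> (u - v)) *\<^sub>R s0 + (n1 \<bullet> (u - v)) *\<^sub>R s1))
    \<le> 2 * sqrt (1 + \<alpha>\<^sup>2)" (is "?L \<le> ?R")
proof -
  define a b a' b' where "a = u \<bullet> n0" and "b = u \<bullet> n1" and "a' = v \<bullet> n0" and "b' = v \<bullet> n1"
  note ab = a_def b_def a'_def b'_def
  define P Q t where "P = norm (n0 + n1)" and "Q = norm (n0 - n1)" and "t = n0 \<bullet> n1"
  have PQ: "P\<^sup>2 + Q\<^sup>2 \<le> 4" using n by (simp add: P_def Q_def parallelogram)
  have PQR: "x * P + y * Q \<le> ?R" if "x\<^sup>2 + y\<^sup>2 \<le> 1 + \<alpha>\<^sup>2" for x y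
    using sum_le_sqrt_of_squares[OF that PQ] by (simp only: real_sqrt_mult real_sqrt_four mult.commute)
  have R1: "P + \<alpha> * Q \<le> ?R" and R2: "\<alpha> * P + Q \<le> ?R"
    using PQR[of 1 \<alpha>] PQR[of \<alpha> 1] by auto
  have ineq: "\<bar>w \<bullet> z\<bar> \<le> norm z" if "norm w \<le> 1" for w z :: 'a
    using Cauchy_Schwarz_ineq2[of w z] mult_left_le_one_le[of "norm z" "norm w"] that by simp
  have le: "\<bar>a + b\<bar> \<le> P" "\<bar>a - b\<bar> \<le> Q" "\<bar>a' + b'\<bar> \<le> P" "\<bar>a' - b'\<bar> \<le> Q"
    unfolding ab P_def Q_def using ineq uv by (simp_all flip: inner_add_right inner_diff_right)
  have t: "\<bar>t\<bar> \<le> 1" using Cauchy_Schwarz_ineq2[of n0 n1] n by (simp add: t_def)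
  \<comment> \<open>A linear form in the overlaps is largest for \<open>u\<close> and
    \<open>v\<close> along the corresponding combinations of \<open>n0\<close> and
    \<open>n1\<close>. The hypothesis bounds the sum of the squared lengths of these
    combinations.\<close>
  have cross: "k0 * a + k1 * b + (l0 * a' + l1 * b') \<le> ?R"
    if "k0\<^sup>2 + k1\<^sup>2 + l0\<^sup>2 + l1\<^sup>2 + 2 * t * (k0 * k1 + l0 * l1) \<le> 2 * (1 + \<alpha>\<^sup>2)" for k0 k1 l0 l1
  proof -
    have "k0 * a + k1 * b + (l0 * a' + l1 * b')
        = u \<bullet> (k0 *\<^sub>R n0 + k1 *\<^sub>R n1) + v \<bullet> (l0 *\<^sub>R n0 + l1 *\<^sub>R n1)"
      by (simp add: ab inner_add)
    also have "\<dots> \<le> 1 * norm (k0 *\<^sub>R n0 + k1 *\<^sub>R n1) + 1 * norm (l0 *\<^sub>R n0 + l1 *\<^sub>R n1)"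
      using ineq[OF uv(1), of "k0 *\<^sub>R n0 + k1 *\<^sub>R n1"] ineq[OF uv(2), of "l0 *\<^sub>R n0 + l1 *\<^sub>R n1"]
      by linarith
    also have "\<dots> \<le> sqrt (2 * (2 * (1 + \<alpha>\<^sup>2)))"
    proof (rule sum_le_sqrt_of_squares)
      have "(norm (k0 *\<^sub>R n0 + k1 *\<^sub>R n1))\<^sup>2 + (norm (l0 *\<^sub>R n0 + l1 *\<^sub>R n1))\<^sup>2
          = k0\<^sup>2 + k1\<^sup>2 + l0\<^sup>2 + l1\<^sup>2 + 2 * t * (k0 * k1 + l0 * l1)"
        using n unfolding norm_eq_1 power2_norm_eq_inner
        by (simp add: t_def inner_add inner_commute algebra_simps power2_eq_square)
      then show "(norm (k0 *\<^sub>R n0 + k1 *\<^sub>R n1))\<^sup>2 + (norm (l0 *\<^sub>R n0 + l1 *\<^sub>R n1))\<^sup>2 \<le> 2 * (1 + \<alpha>\<^sup>2)"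
        using that by simp
    qed simp
    also have "\<dots> = ?R" by (simp only: mult.assoc[symmetric] real_sqrt_mult) simp
    finally show ?thesis .
  qed
  \<comment> \<open>The values 1 and \<open>2 * \<alpha> - 1\<close> are the slopes of
    \<open>\<alpha> * x + (1 - \<alpha>) * \<bar>x\<bar>\<close> on the two half-lines. Since
    \<open>(2 * \<alpha> - 1)\<^sup>2 = 1 - 4 * G\<close>, each slope other than 1 lowers the form
    by \<open>4 * G\<close>; this absorbs the term in \<open>t\<close>, which is present only for
    different slopes.\<close>
  have kl: "k\<^sup>2 + \<alpha>\<^sup>2 + \<alpha>\<^sup>2 + l\<^sup>2 + 2 * t * (\<alpha> * (k - l)) \<le> 2 * (1 + \<alpha>\<^sup>2)"
    if "k = 1 \<or> k = 2 * \<alpha> - 1" "l = 1 \<or> l = 2 * \<alpha> - 1" for k l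
  proof -
    define G where "G = \<alpha> * (1 - \<alpha>)"
    have "0 \<le> G" using \<alpha> by (simp add: G_def)
    then have "\<bar>G * t\<bar> \<le> G" using t by (simp add: abs_mult mult_left_le)
    moreover have "k\<^sup>2 + \<alpha>\<^sup>2 + \<alpha>\<^sup>2 + l\<^sup>2 + 2 * t * (\<alpha> * (k - l)) \<in>
        {2 + 2 * \<alpha>\<^sup>2, 2 + 2 * \<alpha>\<^sup>2 - 4 * G + 4 * (G * t), 2 + 2 * \<alpha>\<^sup>2 - 4 * G - 4 * (G * t),
         2 + 2 * \<alpha>\<^sup>2 - 8 * G}"
      using that unfolding G_def by (elim disjE; hypsubst) (simp_all add: power2_eq_square algebra_simps)
    ultimately show ?thesis using \<open>0 \<le> G\<close> by (simp add: algebra_simps) linarith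
  qed
  have m: "d * (w + w') + d' * (w - w') \<le> 2 * max \<bar>w\<bar> \<bar>w'\<bar>"
    if "\<bar>d\<bar> \<le> 1" "\<bar>d'\<bar> \<le> 1" for d d' w w' :: real
  proof -
    have "d * x \<le> \<bar>x\<bar>" if "\<bar>d\<bar> \<le> 1" for d x :: real
      using mult_left_le_one_le[of "\<bar>x\<bar>" "\<bar>d\<bar>"] that abs_ge_self[of "d * x"] by (simp add: abs_mult)
    from add_mono[OF this[OF that(1), of "w + w'"] this[OF that(2), of "w - w'"]]
    show ?thesis by linarith
  qed
  have cs: "\<bar>c \<bullet> s\<bar> \<le> 1" if "norm c \<le> 1" "norm s \<le> 1" for c s :: 'a
    using ineq[OF that(1), of s] that(2) by linarith
  have "(c0 \<bullet> s0) * (a + a') + (c1 \<bullet> s0) * (a - a') + ((c0 \<bullet> s1) * (b + b') + (c1 \<bullet> s1) * (b - b'))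
      \<le> 2 * max \<bar>a\<bar> \<bar>a'\<bar> + 2 * max \<bar>b\<bar> \<bar>b'\<bar>" (is "?l \<le> ?r")
    by (rule add_mono[OF m[OF cs[OF c(1) s(1)] cs[OF c(2) s(1)]] m[OF cs[OF c(1) s(2)] cs[OF c(2) s(2)]]])
  then have "(1 - \<alpha>) / 2 * ?l \<le> (1 - \<alpha>) / 2 * ?r"
    by (rule mult_left_mono) (use \<alpha> in simp)
  have "?L = \<alpha> * (a + b + a' - b') + (1 - \<alpha>) / 2 *
      ((c0 \<bullet> s0) * (a + a') + (c1 \<bullet> s0) * (a - a') + ((c0 \<bullet> s1) * (b + b') + (c1 \<bullet> s1) * (b - b')))"
    unfolding ab inner_commute[of u] inner_commute[of v] inner_add_right inner_diff_right inner_scaleR_right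
    by (simp add: algebra_simps)
  also have "\<dots> \<le> \<alpha> * (a + b + a' - b') + (1 - \<alpha>) / 2 * ?r"
    by (rule add_left_mono) fact
  also have "\<dots> = \<alpha> * (a + b + a' - b') + (1 - \<alpha>) * (max \<bar>a\<bar> \<bar>a'\<bar> + max \<bar>b\<bar> \<bar>b'\<bar>)"
    by (simp add: field_simps)
  also have "\<dots> \<le> ?R"
  proof -
    \<comment> \<open>If both maxima are attained by \<open>u\<close> or both by \<open>v\<close>, the orthogonality of \<open>n0 + n1\<close> and
      \<open>n0 - n1\<close> decides; otherwise only the two coefficients \<open>k\<close>, \<open>l\<close> depend on signs.\<close>
    have "a + b + a' - b' \<le> P + Q" using le by linarith
    then have ab': "\<alpha> * (a + b + a' - b') \<le> \<alpha> * (P + Q)" by (rule mult_left_mono) fact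
    have P: "\<alpha> * (a + b + a' - b') + (1 - \<alpha>) * x \<le> ?R" if "x \<le> P" for x
    proof -
      have "(1 - \<alpha>) * x \<le> (1 - \<alpha>) * P" using that \<alpha> by (intro mult_left_mono) auto
      moreover have "\<alpha> * (P + Q) + (1 - \<alpha>) * P = P + \<alpha> * Q" by (simp add: algebra_simps)
      ultimately show ?thesis using ab' R1 by linarith
    qed
    have Q: "\<alpha> * (a + b + a' - b') + (1 - \<alpha>) * x \<le> ?R" if "x \<le> Q" for x
    proof -
      have "(1 - \<alpha>) * x \<le> (1 - \<alpha>) * Q" using that \<alpha> by (intro mult_left_mono) auto
      moreover have "\<alpha> * (P + Q) + (1 - \<alpha>) * Q = \<alpha> * P + Q" by (simp add: algebra_simps)
      ultimately show ?thesis using ab' R2 by linarith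
    qed
    have abs_split: "\<alpha> * x + (1 - \<alpha>) * \<bar>x\<bar> = (if 0 \<le> x then 1 else 2 * \<alpha> - 1) * x" for x
      by (simp add: algebra_simps)
    have sign: "(if 0 \<le> x then 1 else 2 * \<alpha> - 1) \<in> {1, 2 * \<alpha> - 1}" for x :: real by simp
    consider "max \<bar>a\<bar> \<bar>a'\<bar> = \<bar>a\<bar>" "max \<bar>b\<bar> \<bar>b'\<bar> = \<bar>b\<bar>" | "max \<bar>a\<bar> \<bar>a'\<bar> = \<bar>a'\<bar>" "max \<bar>b\<bar> \<bar>b'\<bar> = \<bar>b'\<bar>"
      | "max \<bar>a\<bar> \<bar>a'\<bar> = \<bar>a\<bar>" "max \<bar>b\<bar> \<bar>b'\<bar> = \<bar>b'\<bar>" | "max \<bar>a\<bar> \<bar>a'\<bar> = \<bar>a'\<bar>" "max \<bar>b\<bar> \<bar>b'\<bar> = \<bar>b\<bar>"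
      unfolding max_def by presburger
    then show ?thesis
    proof cases
      case 1
      have "\<bar>a\<bar> + \<bar>b\<bar> \<le> P \<or> \<bar>a\<bar> + \<bar>b\<bar> \<le> Q" using le by linarith
      then show ?thesis unfolding 1 using P Q by blast
    next
      case 2
      have "\<bar>a'\<bar> + \<bar>b'\<bar> \<le> P \<or> \<bar>a'\<bar> + \<bar>b'\<bar> \<le> Q" using le by linarith
      then show ?thesis unfolding 2 using P Q by blast
    next
      case 3
      obtain k where k: "\<alpha> * a + (1 - \<alpha>) * \<bar>a\<bar> = k * a" "k = 1 \<or> k = 2 * \<alpha> - 1"
        using abs_split[of a] sign[of a] by blast
      \<comment> \<open>In Bob's term \<open>b'\<close> carries a minus sign, so the slope is taken
        at \<open>- b'\<close>.\<close>
      obtain l where l: "\<alpha> * - b' + (1 - \<alpha>) * \<bar>- b'\<bar> = l * - b'" "l = 1 \<or> l = 2 * \<alpha> - 1"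
        using abs_split[of "- b'"] sign[of "- b'"] by blast
      have "\<alpha> * (a + b + a' - b') + (1 - \<alpha>) * (\<bar>a\<bar> + \<bar>b'\<bar>)
          = (\<alpha> * a + (1 - \<alpha>) * \<bar>a\<bar>) + \<alpha> * b + (\<alpha> * a' + (\<alpha> * - b' + (1 - \<alpha>) * \<bar>- b'\<bar>))"
        by (simp add: algebra_simps)
      also have "\<dots> = k * a + \<alpha> * b + (\<alpha> * a' + (- l) * b')" unfolding k l by simp
      also have "\<dots> \<le> ?R"
        using kl[OF k(2) l(2)] by (intro cross) (simp add: algebra_simps)
      finally show ?thesis unfolding 3 .
    next
      case 4
      obtain k where k: "\<alpha> * a' + (1 - \<alpha>) * \<bar>a'\<bar> = k * a'" "k = 1 \<or> k = 2 * \<alpha> - 1"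
        using abs_split[of a'] sign[of a'] by blast
      obtain l where l: "\<alpha> * b + (1 - \<alpha>) * \<bar>b\<bar> = l * b" "l = 1 \<or> l = 2 * \<alpha> - 1"
        using abs_split[of b] sign[of b] by blast
      have "\<alpha> * (a + b + a' - b') + (1 - \<alpha>) * (\<bar>a'\<bar> + \<bar>b\<bar>)
          = \<alpha> * a + (\<alpha> * b + (1 - \<alpha>) * \<bar>b\<bar>) + ((\<alpha> * a' + (1 - \<alpha>) * \<bar>a'\<bar>) + (- \<alpha>) * b')"
        by (simp add: algebra_simps)
      also have "\<dots> = \<alpha> * a + l * b + (k * a' + (- \<alpha>) * b')" unfolding k l ..
      also have "\<dots> \<le> ?R"
        using kl[OF l(2) k(2)] by (intro cross) (simp add: algebra_simps)
      finally show ?thesis unfolding 4 .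
    qed
  qed
  finally show ?thesis .
qed

text \<open>By homogeneity \<open>f u\<close> is \<open>norm u\<close> times the value at the
  direction \<open>w\<close> of \<open>u\<close>; according to the sign of that value,
  \<open>w\<close> or \<open>- w\<close> does at least as well.\<close>

lemma linear_le_on_sphere:
  fixes f :: "'a::euclidean_space \<Rightarrow> real"
  assumes "linear f" "norm u \<le> 1"
  obtains u' where "norm u' = 1" "f u \<le> f u'"
proof -
  \<comment> \<open>As \<open>sgn 0 = 0\<close>, the zero vector has to be given a direction; any
    unit vector serves.\<close>
  obtain e :: 'a where e: "norm e = 1" using vector_choose_size[of 1] by auto
  define w where "w = (if u = 0 then e else sgn u)"
  have w: "norm w = 1" "u = norm u *\<^sub>R w" using e by (auto simp: w_def norm_sgn sgn_div_norm)
  have fu: "f u = norm u * f w" by (subst w(2)) (simp add: linear_scale[OF assms(1)])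
  show ?thesis
  proof (cases "f w \<ge> 0")
    case True
    then show ?thesis using that[of w] w fu assms(2) by (simp add: mult_left_le_one_le)
  next
    case False
    then have "f u \<le> f (- w)" using fu by (simp add: linear_neg[OF assms(1)] mult_nonneg_nonpos order_trans[of _ 0])
    then show ?thesis using that[of "- w"] w by simp
  qed
qed

text \<open>All three quantities are nonnegative, so comparing squares suffices. The first two cross
  at \<open>1 - 2 / sqrt 7\<close>, the last two at 1/3, by the factorisation
  \<open>(1 + \<alpha>) * (1 - 3 * \<alpha>)\<close>. As the first threshold lies below the second,
  the case distinction in \<open>pvm_bound\<close> selects the maximum.\<close>

lemma pvm_bound_max:
  assumes "0 \<le> \<alpha>" "\<alpha> \<le> 1"
  shows "1/2 + 2 * sqrt 2 * (1 - \<alpha>) / 8 \<le> pvm_bound \<alpha>" (is ?A)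
    and "1/2 + sqrt (4 + (1 - \<alpha>)\<^sup>2) / 8 \<le> pvm_bound \<alpha>" (is ?B)
    and "1/2 + 2 * sqrt (1 + \<alpha>\<^sup>2) / 8 \<le> pvm_bound \<alpha>" (is ?C)
proof -
  define x y z where "x = 2 * sqrt 2 * (1 - \<alpha>)" and "y = sqrt (4 + (1 - \<alpha>)\<^sup>2)"
    and "z = 2 * sqrt (1 + \<alpha>\<^sup>2)"
  have nn: "0 \<le> x" "0 \<le> y" "0 \<le> z" using assms by (auto simp: x_def y_def z_def)
  have sq: "x\<^sup>2 = 8 * (1 - \<alpha>)\<^sup>2" "y\<^sup>2 = 4 + (1 - \<alpha>)\<^sup>2" "z\<^sup>2 = 4 * (1 + \<alpha>\<^sup>2)"
    by (auto simp: x_def y_def z_def power_mult_distrib)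
  have half: "(1 - \<alpha>) / (2 * sqrt 2) = x / 8"
    by (simp add: x_def field_simps)
  have thr: "y \<le> x \<longleftrightarrow> \<alpha> \<le> 1 - 2 / sqrt 7"
  proof -
    have "y \<le> x \<longleftrightarrow> y\<^sup>2 \<le> x\<^sup>2" using nn by simp
    also have "\<dots> \<longleftrightarrow> 2\<^sup>2 \<le> (sqrt 7 * (1 - \<alpha>))\<^sup>2" unfolding sq by (simp add: power_mult_distrib)
    also have "\<dots> \<longleftrightarrow> 2 \<le> sqrt 7 * (1 - \<alpha>)" using assms by (intro power_mono_iff) auto
    also have "\<dots> \<longleftrightarrow> \<alpha> \<le> 1 - 2 / sqrt 7" by (simp add: field_simps)
    finally show ?thesis .
  qed
  have yz: "z \<le> y \<longleftrightarrow> \<alpha> \<le> 1/3"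
  proof -
    have "z \<le> y \<longleftrightarrow> z\<^sup>2 \<le> y\<^sup>2" using nn by simp
    also have "\<dots> \<longleftrightarrow> 0 \<le> (1 + \<alpha>) * (1 - 3 * \<alpha>)" unfolding sq by (simp add: power2_eq_square algebra_simps)
    also have "\<dots> \<longleftrightarrow> \<alpha> \<le> 1/3" using assms by (auto simp: zero_le_mult_iff)
    finally show ?thesis .
  qed
  have "sqrt 7 \<le> 3" by (rule real_le_lsqrt) auto
  then have "1 - 2 / sqrt 7 \<le> 1/3" by (simp add: field_simps)
  then have *: "pvm_bound \<alpha> = 1/2 + (if y \<le> x then x else if z \<le> y then y else z) / 8"
    "y \<le> x \<Longrightarrow> z \<le> y"
    using thr yz by (auto simp: pvm_bound_def half y_def z_def)
  show ?A ?B ?C unfolding *(1) x_def[symmetric] y_def[symmetric] z_def[symmetric]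
    using *(2) by auto
qed

subsection \<open>Bloch coordinates\<close>

text \<open>The Hermitian operator \<open>t\<close> times the identity plus the inner product of
  \<open>r\<close> with the vector of Pauli matrices. A state with Bloch vector \<open>r\<close> is
  \<open>pauli (1/2) ((1/2) *\<^sub>R r)\<close>.\<close>

definition pauli :: "real \<Rightarrow> real^3 \<Rightarrow> qop" where
  "pauli t r = vector [vector [of_real (t + r $ 3), Complex (r $ 1) (- r $ 2)],
                       vector [Complex (r $ 1) (r $ 2), of_real (t - r $ 3)]]"

text \<open>The vector of Pauli coefficients, half the Bloch vector in the case of a state. Real and
  imaginary parts make it a real-linear map on all operators, not only on Hermitian ones.\<close>

definition bloch :: "qop \<Rightarrow> real^3" where
  "bloch A = vector [Re (A $ 1 $ 2 + A $ 2 $ 1) / 2, Im (A $ 2 $ 1 - A $ 1 $ 2) / 2,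
    Re (A $ 1 $ 1 - A $ 2 $ 2) / 2]"

lemma pauli_nth [simp]:
  "pauli t r $ 1 $ 1 = of_real (t + r $ 3)" "pauli t r $ 1 $ 2 = Complex (r $ 1) (- r $ 2)"
  "pauli t r $ 2 $ 1 = Complex (r $ 1) (r $ 2)" "pauli t r $ 2 $ 2 = of_real (t - r $ 3)"
  by (simp_all add: pauli_def)

lemma qop_eq_iff:
  fixes A B :: qop
  shows "A = B \<longleftrightarrow> A$1$1 = B$1$1 \<and> A$1$2 = B$1$2 \<and> A$2$1 = B$2$1 \<and> A$2$2 = B$2$2"
  by (auto simp: vec_eq_iff forall_2)

lemma bloch_pauli [simp]: "bloch (pauli t r) = r"
  by (simp add: bloch_def vec_eq_iff forall_3)

lemma trace_pauli [simp]: "trace (pauli t r) = of_real (2 * t)"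
  by (simp add: trace_def sum_2)

lemma pauli_add: "pauli t r + pauli t' r' = pauli (t + t') (r + r')"
  by (simp add: qop_eq_iff complex_eq_iff)

lemma pauli_diff: "pauli t r - pauli t' r' = pauli (t - t') (r - r')"
  by (simp add: qop_eq_iff complex_eq_iff)

lemma pauli_scaleR: "k *\<^sub>R pauli t r = pauli (k * t) (k *\<^sub>R r)"
  by (simp add: qop_eq_iff complex_eq_iff algebra_simps)

lemma mat_1_pauli: "mat 1 = pauli 1 0"
  by (simp add: qop_eq_iff mat_def complex_eq_iff)

lemma linear_bloch: "linear bloch"
  by (rule linearI) (simp_all add: bloch_def vec_eq_iff forall_3 algebra_simps add_divide_distrib diff_divide_distrib)

lemma linear_Re_trace: "linear (\<lambda>A :: qop. Re (trace A))"
  by (rule linearI) (simp_all add: trace_def sum_2 algebra_simps)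

lemma inner_3: "r \<bullet> s = r $ 1 * s $ 1 + r $ 2 * s $ 2 + r $ 3 * s $ (3::3)" for r s :: "real^3"
  by (simp add: inner_vec_def sum_3)

lemma trace_pauli_mult: "trace (pauli t r ** pauli t' r') = of_real (2 * (t * t' + r \<bullet> r'))"
  by (simp add: trace_def matrix_matrix_mult_def sum_2 inner_3 complex_eq_iff algebra_simps)

text \<open>The eigenvalues are \<open>t + norm r\<close> and \<open>t - norm r\<close>. One
  direction reads this off the diagonal and the determinant, the other applies Cauchy-Schwarz to the
  expectation in an arbitrary vector.\<close>

lemma psd_pauli_iff: "psd (pauli t r) \<longleftrightarrow> norm r \<le> t"
proof
  assume "psd (pauli t r)"
  then obtain a d z where *: "0 \<le> a" "0 \<le> d" "(cmod z)\<^sup>2 \<le> a * d"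
    "pauli t r $ 1 $ 1 = of_real a" "pauli t r $ 2 $ 2 = of_real d" "pauli t r $ 1 $ 2 = z"
    by (rule psd_2)
  then have "a = t + r $ 3" "d = t - r $ 3" "z = Complex (r $ 1) (- r $ 2)"
    by (simp_all only: pauli_nth of_real_eq_iff)
  then have "(r $ 1)\<^sup>2 + (r $ 2)\<^sup>2 \<le> (t + r $ 3) * (t - r $ 3)" and "0 \<le> t"
    using *(1-3) by (simp_all add: cmod_power2)
  then have "(norm r)\<^sup>2 \<le> t\<^sup>2" and "0 \<le> t"
    unfolding power2_norm_eq_inner inner_3 by (simp_all add: power2_eq_square algebra_simps)
  then show "norm r \<le> t" by (rule power2_le_imp_le)
next
  assume "norm r \<le> t"
  then have t: "0 \<le> t" and "(norm r)\<^sup>2 \<le> t\<^sup>2"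
    by (auto intro: power_mono order_trans[OF norm_ge_zero])
  then have r: "(r $ 1)\<^sup>2 + (r $ 2)\<^sup>2 + (r $ 3)\<^sup>2 \<le> t\<^sup>2"
    unfolding power2_norm_eq_inner inner_3 by (simp add: power2_eq_square)
  show "psd (pauli t r)" unfolding psd_def
  proof
    fix v :: "complex^2"
    define a b z where "a = v $ 1" and "b = v $ 2" and "z = cnj a * b"
    \<comment> \<open>\<open>w\<close> holds the expectations of the Pauli matrices in the
      unnormalised vector \<open>v\<close>. Its length is the squared norm \<open>w0\<close> of
      \<open>v\<close>, as for any pure state.\<close>
    define w :: "real^3" where "w = vector [2 * Re z, 2 * Im z, (cmod a)\<^sup>2 - (cmod b)\<^sup>2]"
    define w0 where "w0 = (cmod a)\<^sup>2 + (cmod b)\<^sup>2"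
    have "(norm w)\<^sup>2 = w \<bullet> w" by (rule power2_norm_eq_inner)
    also have "\<dots> = 4 * (cmod z)\<^sup>2 + ((cmod a)\<^sup>2 - (cmod b)\<^sup>2)\<^sup>2"
      unfolding inner_3 cmod_power2[of z] by (simp add: w_def power2_eq_square)
    also have "\<dots> = w0\<^sup>2"
      by (simp add: z_def w0_def norm_mult power2_eq_square algebra_simps)
    finally have "norm w = w0" by (simp add: w0_def)
    then have "- (r \<bullet> w) \<le> t * w0"
      using Cauchy_Schwarz_ineq2[of r w] mult_right_mono[OF \<open>norm r \<le> t\<close> norm_ge_zero[of w]]
      by simp
    moreover have "cinner v (pauli t r *v v) = of_real (t * w0 + r \<bullet> w)"
      unfolding w0_def w_def inner_3 cmod_power2
      by (simp add: cinner_def matrix_vector_mult_def sum_2 z_def complex_eq_iff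
          flip: a_def b_def)
        (simp add: power2_eq_square algebra_simps)
    ultimately show "cinner v (pauli t r *v v) \<in> \<real>\<^sub>\<ge>\<^sub>0"
      by (simp only: nonneg_Reals_of_real_iff)
  qed
qed

section \<open>States, POVMs and PVMs in Bloch coordinates\<close>

lemma psd_pauli:
  assumes "psd A"
  obtains t r where "A = pauli t r" "norm r \<le> t"
proof -
  obtain a d z where *: "A $ 1 $ 1 = of_real a" "A $ 2 $ 2 = of_real d" "A $ 1 $ 2 = z" "A $ 2 $ 1 = cnj z"
    using assms by (rule psd_2)
  define r :: "real^3" where "r = vector [Re z, - Im z, (a - d) / 2]"
  have "A = pauli ((a + d) / 2) r"
    by (simp add: qop_eq_iff * r_def complex_eq_iff field_simps)
  with that[OF this] assms show ?thesis by (simp add: psd_pauli_iff)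
qed

lemma density_pauli:
  assumes "density \<rho>"
  obtains r where "\<rho> = pauli (1/2) ((1/2) *\<^sub>R r)" "norm r \<le> 1"
proof -
  obtain t r where *: "\<rho> = pauli t r" "norm r \<le> t"
    using assms psd_pauli unfolding density_def by blast
  moreover have "t = 1/2" using assms of_real_eq_iff[of "2 * t" 1, where 'a = complex] unfolding density_def *(1) trace_pauli by simp
  ultimately show ?thesis using that[of "2 *\<^sub>R r"] by simp
qed

text \<open>Positivity of the two effects bounds the Pauli vector by \<open>m\<close> and by
  \<open>1 - m\<close>, hence by 1/2; \<open>c\<close> is its double.\<close>

lemma povm_pauli:
  assumes "povm E"
  obtains m c where "E False = pauli m ((1/2) *\<^sub>R c)" "E True = mat 1 - E False" "norm c \<le> 1"
proof -
  have sum: "E False + E True = mat 1" and psd: "psd (E False)" "psd (E True)"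
    using assms by (auto simp: povm_def)
  then have T: "E True = mat 1 - E False" by (simp add: eq_diff_eq add.commute)
  obtain m r where F: "E False = pauli m r" "norm r \<le> m" using psd(1) by (rule psd_pauli)
  have "norm r \<le> 1 - m" using psd(2) unfolding T F mat_1_pauli pauli_diff psd_pauli_iff by simp
  then show ?thesis using that[of m "2 *\<^sub>R r"] F T by simp
qed

text \<open>Comparing Pauli vectors in the idempotence equation gives \<open>n = 0\<close> or
  \<open>m = 1/2\<close>; comparing traces then gives \<open>norm n = 1\<close> in the second case.
  The trivial pairs are those with \<open>n = 0\<close>.\<close>

lemma pvm_pauli:
  assumes "pvm E"
  obtains m n where "E False = pauli m ((1/2) *\<^sub>R n)" "E True = mat 1 - E False"
    "n = 0 \<or> norm n = 1 \<and> m = 1/2"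
proof -
  obtain m n where E: "E False = pauli m ((1/2) *\<^sub>R n)" "E True = mat 1 - E False" "norm n \<le> 1"
    using assms povm_pauli unfolding pvm_def by blast
  have idem: "E False ** E False = E False" using assms by (simp add: pvm_def)
  have "bloch (E False ** E False) = (2 * m) *\<^sub>R ((1/2) *\<^sub>R n)"
    unfolding E by (simp add: bloch_def matrix_matrix_mult_def sum_2 vec_eq_iff forall_3 field_simps)
  then have 1: "n = 0 \<or> m = 1/2" unfolding idem unfolding E by auto
  have "trace (E False ** E False) = of_real (2 * (m * m + (norm n)\<^sup>2 / 4))"
    unfolding E trace_pauli_mult power2_norm_eq_inner by simp
  then have "2 * m = 2 * (m * m + (norm n)\<^sup>2 / 4)"
    unfolding idem unfolding E trace_pauli of_real_eq_iff .
  then have "n = 0 \<or> norm n = 1 \<and> m = 1/2"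
  proof (cases "n = 0")
    case False
    then have m: "m = 1/2" using 1 by simp
    then have "(norm n)\<^sup>2 = 1\<^sup>2" using \<open>2 * m = _\<close> unfolding m by simp
    then show ?thesis using m by (simp only: power2_eq_iff_nonneg norm_ge_zero zero_le_one) simp
  qed simp
  with E that show ?thesis by blast
qed

subsection \<open>Positive maps and instruments\<close>

text \<open>Here \<open>linear\<close> is over the reals, in accordance with the real span of the
  operators \<open>pauli t r\<close>.\<close>

definition positive_map :: "(qop \<Rightarrow> qop) \<Rightarrow> bool" where
  "positive_map \<Phi> \<longleftrightarrow> linear \<Phi> \<and> (\<forall>A. psd A \<longrightarrow> psd (\<Phi> A))"

lemma completely_positive_imp_positive_map:
  assumes "completely_positive \<Phi>"
  shows "positive_map \<Phi>"
proof -
  have "module_hom cscale cscale \<Phi>"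
    using assms by (auto simp: completely_positive_def Vector_Spaces.linear_def)
  moreover have "k *\<^sub>R X = cscale (of_real k) X" for k and X :: qop
    by (simp add: qop_eq_iff cscale_def complex_eq_iff)
  ultimately have "linear \<Phi>"
    by (intro linearI) (simp_all add: module_hom.add module_hom.scale)
  then show ?thesis
    using completely_positive_psd[OF assms] by (simp add: positive_map_def)
qed

lemma positive_map_add:
  assumes "positive_map \<Phi>" "positive_map \<Psi>"
  shows "positive_map (\<lambda>X. \<Phi> X + \<Psi> X)"
  unfolding positive_map_def
proof (intro conjI allI impI)
  show "linear (\<lambda>X. \<Phi> X + \<Psi> X)"
    using assms by (auto simp: positive_map_def intro: linear_compose_add)
  fix A :: qop assume "psd A"
  then have "psd (\<Phi> A)" "psd (\<Psi> A)" using assms by (auto simp: positive_map_def)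
  then show "psd (\<Phi> A + \<Psi> A)"
    by (elim psd_pauli) (auto simp: pauli_add psd_pauli_iff intro: norm_triangle_le)
qed

text \<open>A positive map preserves Hermitian operators, these being differences of positive ones,
  and a Hermitian operator is determined by its trace and its Pauli vector.\<close>

lemma positive_map_pauli:
  assumes "positive_map \<Phi>"
  shows "\<Phi> (pauli t r) = pauli (Re (trace (\<Phi> (pauli t r))) / 2) (bloch (\<Phi> (pauli t r)))"
proof -
  \<comment> \<open>Large enough for both \<open>pauli ?s r\<close> and
    \<open>pauli (?s - t) 0\<close> to be positive.\<close>
  let ?s = "norm r + \<bar>t\<bar>"
  have "psd (pauli ?s r)" "psd (pauli (?s - t) 0)"
    by (auto simp: psd_pauli_iff intro: add_increasing)
  then have "psd (\<Phi> (pauli ?s r))" "psd (\<Phi> (pauli (?s - t) 0))"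
    using assms by (auto simp: positive_map_def)
  moreover have "\<Phi> (pauli t r) = \<Phi> (pauli ?s r) - \<Phi> (pauli (?s - t) 0)"
    using assms by (simp add: positive_map_def pauli_diff linear_diff[of \<Phi>, symmetric])
  ultimately obtain t' r' where "\<Phi> (pauli t r) = pauli t' r'"
    by (elim psd_pauli) (simp add: pauli_diff)
  then show ?thesis by simp
qed

lemma positive_map_norm_le:
  assumes "positive_map \<Phi>" "norm r \<le> t"
  shows "norm (bloch (\<Phi> (pauli t r))) \<le> Re (trace (\<Phi> (pauli t r))) / 2"
proof -
  have "psd (\<Phi> (pauli t r))" using assms by (simp add: positive_map_def psd_pauli_iff)
  then show ?thesis by (subst (asm) positive_map_pauli[OF assms(1)]) (simp only: psd_pauli_iff)
qed

text \<open>Twice \<open>pauli 0 r\<close> is a difference of two positive operators of trace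
  \<open>2 * norm r\<close>. Their images have the same trace, hence Pauli vectors of length at most
  \<open>norm r\<close>, and the common offset of a non-unital map cancels.\<close>

lemma bloch_contraction:
  assumes "positive_map \<Phi>" and tr: "\<And>X. trace (\<Phi> X) = trace X"
  shows "norm (bloch (\<Phi> (pauli 0 r))) \<le> norm r"
proof -
  have lin: "linear \<Phi>" using assms(1) by (simp add: positive_map_def)
  let ?b = "\<lambda>s. bloch (\<Phi> (pauli (norm r) s))"
  have "2 *\<^sub>R pauli 0 r = pauli (norm r) r - pauli (norm r) (- r)"
    by (simp add: pauli_scaleR pauli_diff scaleR_2)
  then have "2 *\<^sub>R bloch (\<Phi> (pauli 0 r)) = ?b r - ?b (- r)"
    by (simp only: linear_scale[OF lin, symmetric] linear_scale[OF linear_bloch, symmetric]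
        linear_diff[OF lin] linear_diff[OF linear_bloch])
  then have "norm (2 *\<^sub>R bloch (\<Phi> (pauli 0 r))) = norm (?b r - ?b (- r))" by (rule arg_cong)
  then have "2 * norm (bloch (\<Phi> (pauli 0 r))) = norm (?b r - ?b (- r))" by simp
  also have "\<dots> \<le> norm (?b r) + norm (?b (- r))" by (rule norm_triangle_ineq4)
  also have "\<dots> \<le> norm r + norm r"
    using positive_map_norm_le[OF assms(1), of r "norm r"]
      positive_map_norm_le[OF assms(1), of "- r" "norm r"]
    by (intro add_mono) (simp_all add: tr)
  finally show ?thesis by simp
qed

text \<open>
  The states with Bloch vector proportional to \<open>(1 - k\<^sup>2) m + 2 k r\<close> have images that are
  quadratic in \<open>k\<close> without constant term, so positivity near \<open>k = 0\<close> forces the linear term to vanish.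
\<close>

lemma positive_map_vanish_orthogonal:
  assumes \<Phi>: "positive_map \<Phi>" and m: "norm m = 1" "trace (\<Phi> (pauli 1 m)) = 0" and r: "m \<bullet> r = 0"
  shows "bloch (\<Phi> (pauli 0 r)) = 0"
proof -
  have lin: "linear \<Phi>" using \<Phi> by (simp add: positive_map_def)
  have zero: "\<Phi> (pauli 1 m) = 0"
  proof -
    have "bloch (\<Phi> (pauli 1 m)) = 0" using positive_map_norm_le[OF \<Phi>, of m 1] m by simp
    then have "\<Phi> (pauli 1 m) = pauli 0 0" using positive_map_pauli[OF \<Phi>, of 1 m] m(2) by simp
    then show ?thesis by (simp add: qop_eq_iff complex_eq_iff)
  qed
  define n where "n = norm r"
  define R where "R = bloch (\<Phi> (pauli 0 r))"
  define \<tau> \<sigma> where "\<tau> = Re (trace (\<Phi> (pauli 1 (- m))))" and "\<sigma> = Re (trace (\<Phi> (pauli 0 r)))"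
  have bound: "norm ((k\<^sup>2 * n\<^sup>2) *\<^sub>R bloch (\<Phi> (pauli 1 (- m))) + (2 * k) *\<^sub>R R)
      \<le> (k\<^sup>2 * n\<^sup>2 * \<tau> + 2 * k * \<sigma>) / 2" for k
  proof -
    \<comment> \<open>Rational parametrisation of a circle: \<open>(1 - s\<^sup>2)\<^sup>2 + (2 *
      s)\<^sup>2 = (1 + s\<^sup>2)\<^sup>2\<close> with \<open>s = k * n\<close>. It keeps the
      operator on the boundary of the positive cone and polynomial in \<open>k\<close>.\<close>
    let ?t = "1 + k\<^sup>2 * n\<^sup>2" and ?r = "(1 - k\<^sup>2 * n\<^sup>2) *\<^sub>R m + (2 * k) *\<^sub>R r"
    have "(norm ?r)\<^sup>2 = ?t\<^sup>2"
    proof -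
      have "(norm ?r)\<^sup>2 = (1 - k\<^sup>2 * n\<^sup>2)\<^sup>2 * (m \<bullet> m) + 2 * (1 - k\<^sup>2 * n\<^sup>2) * (2 * k) * (m \<bullet> r)
          + (2 * k)\<^sup>2 * (r \<bullet> r)"
        unfolding power2_norm_eq_inner[of ?r] inner_add_left inner_add_right inner_scaleR_left
          inner_scaleR_right inner_commute[of r m] by (simp add: power2_eq_square algebra_simps)
      also have "\<dots> = (1 - k\<^sup>2 * n\<^sup>2)\<^sup>2 + 4 * (k\<^sup>2 * n\<^sup>2)"
        using m(1) r unfolding norm_eq_1 n_def power2_norm_eq_inner[of r]
        by (simp add: power_mult_distrib)
      also have "\<dots> = ?t\<^sup>2" by (simp add: power2_eq_square algebra_simps)
      finally show ?thesis .
    qed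
    then have "norm ?r = ?t" by (simp add: power2_eq_iff_nonneg)
    moreover have "\<Phi> (pauli ?t ?r) = (k\<^sup>2 * n\<^sup>2) *\<^sub>R \<Phi> (pauli 1 (- m)) + (2 * k) *\<^sub>R \<Phi> (pauli 0 r)"
    proof -
      have "pauli ?t ?r = pauli 1 m + (k\<^sup>2 * n\<^sup>2) *\<^sub>R pauli 1 (- m) + (2 * k) *\<^sub>R pauli 0 r"
        by (simp add: pauli_add pauli_scaleR algebra_simps)
      then show ?thesis by (simp add: linear_add[OF lin] linear_scale[OF lin] zero)
    qed
    ultimately show ?thesis
      using positive_map_norm_le[OF \<Phi>, of ?r ?t]
      by (simp only: linear_add[OF linear_bloch] linear_scale[OF linear_bloch]
          linear_add[OF linear_Re_trace] linear_scale[OF linear_Re_trace]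
          \<tau>_def \<sigma>_def R_def real_scaleR_def order_refl)
  qed
  have small: "4 * norm R \<le> k * (n\<^sup>2 * \<tau>)" if "k > 0" for k
  proof -
    let ?A = "(k\<^sup>2 * n\<^sup>2) *\<^sub>R bloch (\<Phi> (pauli 1 (- m)))"
    \<comment> \<open>Combining the bounds at \<open>k\<close> and \<open>- k\<close> removes the
      quadratic vector on the left and the linear trace term \<open>\<sigma>\<close> on the
      right.\<close>
    have "4 * k * norm R = norm ((?A + (2 * k) *\<^sub>R R) - (?A + (2 * - k) *\<^sub>R R))"
      using that by (simp flip: scaleR_add_left)
    also have "\<dots> \<le> norm (?A + (2 * k) *\<^sub>R R) + norm (?A + (2 * - k) *\<^sub>R R)"
      by (rule norm_triangle_ineq4)
    also have "\<dots> \<le> k * (k * (n\<^sup>2 * \<tau>))"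
      using bound[of k] bound[of "- k"] by (simp add: power2_eq_square)
    finally show ?thesis using that by simp
  qed
  have "norm R \<le> 0"
  proof (rule ccontr)
    assume R: "\<not> norm R \<le> 0"
    \<comment> \<open>Small enough that \<open>small\<close> would give
      \<open>4 * norm R \<le> norm R\<close>; the summand 1 keeps the denominator positive.\<close>
    define k where "k = norm R / (\<bar>n\<^sup>2 * \<tau>\<bar> + 1)"
    have "k > 0" using R by (simp add: k_def)
    have "k * (n\<^sup>2 * \<tau>) \<le> k * (\<bar>n\<^sup>2 * \<tau>\<bar> + 1)" using \<open>k > 0\<close> by (intro mult_left_mono) auto
    also have "\<dots> = norm R" by (simp add: k_def)
    finally show False using small[OF \<open>k > 0\<close>] R by simp
  qed
  then show ?thesis by (simp add: R_def)
qed

section \<open>Bias and Bloch map of an instrument\<close>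

text \<open>On a state with Bloch vector \<open>r\<close>, outcome \<open>False\<close> has
  probability a constant plus \<open>bias B r / 2\<close>.\<close>

definition bias :: "(bool \<Rightarrow> qop \<Rightarrow> qop) \<Rightarrow> real^3 \<Rightarrow> real" where
  "bias B r = Re (trace (B False (pauli 0 r)))"

text \<open>The linear part of the affine action on the Bloch ball of the channel that forgets Bob's
  outcome. The offset is left out because only differences of Alice's states enter the gain.\<close>

definition bloch_map :: "(bool \<Rightarrow> qop \<Rightarrow> qop) \<Rightarrow> real^3 \<Rightarrow> real^3" where
  "bloch_map B r = bloch (B False (pauli 0 r) + B True (pauli 0 r))"

lemma instrument_positive_map:
  assumes "instrument B"
  shows "positive_map (B b)" and "positive_map (\<lambda>X. B False X + B True X)"
    and "trace (B False X + B True X) = trace X"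
  using assms
  by (auto simp: instrument_def intro: completely_positive_imp_positive_map positive_map_add)

lemma instrument_linear:
  assumes "instrument B"
  shows "linear (B b)"
  using instrument_positive_map(1)[OF assms] by (simp add: positive_map_def)

lemma linear_pauli_0: "linear (pauli 0)"
  by (rule linearI) (simp_all add: pauli_add pauli_scaleR)

lemma linear_bias:
  assumes "instrument B"
  shows "linear (bias B)"
proof -
  have lin: "linear (B False)" using assms by (rule instrument_linear)
  show ?thesis unfolding bias_def
    by (rule linearI) (simp_all only: linear_add[OF linear_pauli_0] linear_scale[OF linear_pauli_0]
        linear_add[OF lin] linear_scale[OF lin] linear_add[OF linear_Re_trace]
        linear_scale[OF linear_Re_trace])
qed

lemma linear_bloch_map:
  assumes "instrument B"
  shows "linear (bloch_map B)"
proof -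
  have lin: "linear (\<lambda>X. B False X + B True X)"
    using instrument_positive_map(2)[OF assms] by (simp add: positive_map_def)
  show ?thesis unfolding bloch_map_def
    by (rule linearI) (simp_all only: linear_add[OF linear_pauli_0] linear_scale[OF linear_pauli_0]
        linear_add[OF lin] linear_scale[OF lin] linear_add[OF linear_bloch]
        linear_scale[OF linear_bloch])
qed

lemma bloch_map_contraction:
  assumes "instrument B"
  shows "norm (bloch_map B r) \<le> norm r"
  unfolding bloch_map_def using assms by (intro bloch_contraction instrument_positive_map)

lemma linear_trace: "linear (\<lambda>X :: qop. trace X)"
  by (rule linearI) (simp_all add: trace_def sum_2 scaleR_add_right)

lemma linear_trace_mult: "linear (\<lambda>X :: qop. trace (X ** C))"
  by (rule linearI)
    (simp_all add: trace_def matrix_matrix_mult_def sum_2 distrib_right scaleR_add_right)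

section \<open>Instruments compatible with a PVM\<close>

text \<open>Compatibility speaks of states only. It extends by scaling to positive multiples of
  states and by linearity to their differences, which are all Hermitian operators.\<close>

lemma compatible_pauli:
  assumes B: "instrument B" and E: "compatible B E"
  shows "trace (B b (pauli t r)) = trace (pauli t r ** E b)"
proof -
  have lin: "linear (B b)" using B by (rule instrument_linear)
  have pos: "trace (B b (pauli t r)) = trace (pauli t r ** E b)" if "norm r \<le> t" "0 < t" for t r
  proof -
    let ?\<rho> = "pauli (1/2) ((1 / (2 * t)) *\<^sub>R r)"
    have "density ?\<rho>" using that by (simp add: density_def psd_pauli_iff field_simps)
    then have "trace (B b ?\<rho>) = trace (?\<rho> ** E b)" using E by (simp add: compatible_def)
    moreover have "pauli t r = (2 * t) *\<^sub>R ?\<rho>" using that by (simp add: pauli_scaleR)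
    ultimately show ?thesis
      by (simp only: linear_scale[OF lin] linear_scale[OF linear_trace]
          linear_scale[OF linear_trace_mult])
  qed
  \<comment> \<open>The summand 1 gives both operators strictly positive trace, so that each is a
    positive multiple of a state.\<close>
  let ?k = "norm r + \<bar>t\<bar> + 1"
  have *: "pauli t r = pauli (t + ?k) r - pauli ?k 0" by (simp add: pauli_diff)
  have "trace (B b (pauli t r)) = trace (B b (pauli (t + ?k) r)) - trace (B b (pauli ?k 0))"
    unfolding * by (simp only: linear_diff[OF lin] trace_sub)
  also have "\<dots> = trace (pauli (t + ?k) r ** E b) - trace (pauli ?k 0 ** E b)"
  proof -
    have "norm r \<le> t + ?k" "0 < t + ?k" "0 \<le> ?k" "0 < ?k"
      using norm_ge_zero[of r] by linarith+
    then show ?thesis by (simp only: pos norm_zero)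
  qed
  also have "\<dots> = trace (pauli t r ** E b)"
    unfolding * by (simp only: linear_diff[OF linear_trace_mult])
  finally show ?thesis .
qed

text \<open>In the rank-one case outcome \<open>False\<close> never occurs on the state along
  \<open>- n\<close>, and outcome \<open>True\<close> never on the state along \<open>n\<close>. By
  \<open>positive_map_vanish_orthogonal\<close> both branches then annihilate the directions
  orthogonal to \<open>n\<close>, so the Bloch map sees only the component along
  \<open>n\<close>.\<close>

lemma pvm_instrument_form:
  assumes B: "instrument B" and E: "pvm E" "compatible B E"
  obtains n where "\<And>r. bias B r = n \<bullet> r"
    "n = 0 \<or> norm n = 1 \<and> (\<forall>r. bloch_map B r = (n \<bullet> r) *\<^sub>R bloch_map B n)"
proof -
  obtain m n where mn: "E False = pauli m ((1/2) *\<^sub>R n)" "E True = mat 1 - E False"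
    "n = 0 \<or> norm n = 1 \<and> m = 1/2"
    using E(1) by (rule pvm_pauli)
  have ET: "E True = pauli (1 - m) ((-1/2) *\<^sub>R n)"
    unfolding mn(2) unfolding mn(1) mat_1_pauli pauli_diff by simp
  note tr = compatible_pauli[OF B E(2)]
  have "bias B r = n \<bullet> r" for r
    by (simp add: bias_def tr mn(1) trace_pauli_mult inner_commute)
  moreover have "bloch_map B r = (n \<bullet> r) *\<^sub>R bloch_map B n" if n: "norm n = 1" "m = 1/2" for r
  proof -
    note lin = linear_bloch_map[OF B]
    have "bloch_map B s = 0" if "n \<bullet> s = 0" for s
    proof -
      have "bloch (B False (pauli 0 s)) = 0"
      proof (rule positive_map_vanish_orthogonal[OF instrument_positive_map(1)[OF B], of "- n"])
        show "trace (B False (pauli 1 (- n))) = 0"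
          using n(1) unfolding tr mn(1) n(2) trace_pauli_mult by (simp add: norm_eq_1)
      qed (use n that in auto)
      moreover have "bloch (B True (pauli 0 s)) = 0"
      proof (rule positive_map_vanish_orthogonal[OF instrument_positive_map(1)[OF B], of n])
        show "trace (B True (pauli 1 n)) = 0"
          using n(1) unfolding tr ET n(2) trace_pauli_mult by (simp add: norm_eq_1)
      qed (use n that in auto)
      ultimately show ?thesis by (simp add: bloch_map_def linear_add[OF linear_bloch])
    qed
    moreover have "n \<bullet> (r - (n \<bullet> r) *\<^sub>R n) = 0" using n by (simp add: inner_diff norm_eq_1)
    ultimately have "bloch_map B (r - (n \<bullet> r) *\<^sub>R n) = 0" .
    then show ?thesis by (simp add: linear_diff[OF lin] linear_scale[OF lin])
  qed
  ultimately show ?thesis using mn(3) that by blast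
qed

subsection \<open>The success probability\<close>

text \<open>The vectors \<open>u\<close> and \<open>v\<close> are half the differences of Alice's
  Bloch vectors for the inputs 00 and 11, and 01 and 10. Her first bit is then encoded along
  \<open>u + v\<close>, her second along \<open>u - v\<close>. The factor 1/2 is the average over
  Bob's input in Charlie's probability.\<close>

definition gain ::
  "real \<Rightarrow> (bool \<Rightarrow> qop \<Rightarrow> qop) \<Rightarrow> (bool \<Rightarrow> qop \<Rightarrow> qop) \<Rightarrow> real^3 \<Rightarrow> real^3 \<Rightarrow> real^3 \<Rightarrow> real^3 \<Rightarrow> real"
where
  "gain \<alpha> B0 B1 c0 c1 u v = \<alpha> * (bias B0 (u + v) + bias B1 (u - v)) + (1 - \<alpha>) / 2 *
    (c0 \<bullet> (bloch_map B0 (u + v) + bloch_map B1 (u + v))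
      + c1 \<bullet> (bloch_map B0 (u - v) + bloch_map B1 (u - v)))"

text \<open>The gain is a linear function of \<open>u\<close> plus a linear function of
  \<open>v\<close>, so each can be moved to the sphere separately. For unit vectors
  \<open>u + v\<close> and \<open>u - v\<close> are orthogonal with squared lengths summing to 4, as
  \<open>one_trivial_bound\<close> requires.\<close>

lemma gain_le_sphere:
  assumes B: "instrument B0" "instrument B1" and uv: "norm u \<le> 1" "norm v \<le> 1"
  obtains u' v' where "norm u' = 1" "norm v' = 1" "gain \<alpha> B0 B1 c0 c1 u v \<le> gain \<alpha> B0 B1 c0 c1 u' v'"
proof -
  note lin = linear_bias[OF B(1)] linear_bias[OF B(2)] linear_bloch_map[OF B(1)] linear_bloch_map[OF B(2)]
  define f where "f u = \<alpha> * (bias B0 u + bias B1 u) + (1 - \<alpha>) / 2 *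
    (c0 \<bullet> (bloch_map B0 u + bloch_map B1 u) + c1 \<bullet> (bloch_map B0 u + bloch_map B1 u))" for u
  define g where "g v = \<alpha> * (bias B0 v - bias B1 v) + (1 - \<alpha>) / 2 *
    (c0 \<bullet> (bloch_map B0 v + bloch_map B1 v) - c1 \<bullet> (bloch_map B0 v + bloch_map B1 v))" for v
  have "linear f" "linear g"
    unfolding f_def g_def
    by (rule linearI; simp only: lin[THEN linear_add] lin[THEN linear_scale] inner_add_right
        inner_scaleR_right real_scaleR_def; simp add: field_simps)+
  have split: "gain \<alpha> B0 B1 c0 c1 u v = f u + g v" for u v
    unfolding gain_def f_def g_def lin[THEN linear_add] lin[THEN linear_diff] inner_add_right inner_diff_right
    by (simp add: field_simps)
  obtain u' where u': "norm u' = 1" "f u \<le> f u'"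
    using linear_le_on_sphere[OF \<open>linear f\<close> uv(1)] .
  obtain v' where v': "norm v' = 1" "g v \<le> g v'"
    using linear_le_on_sphere[OF \<open>linear g\<close> uv(2)] .
  have "gain \<alpha> B0 B1 c0 c1 u v \<le> gain \<alpha> B0 B1 c0 c1 u' v'"
    unfolding split using u'(2) v'(2) by (rule add_mono)
  with u'(1) v'(1) show ?thesis by (rule that)
qed

lemma gain_pvm_le:
  assumes B0: "instrument B0" "pvm E0" "compatible B0 E0" and B1: "instrument B1" "pvm E1" "compatible B1 E1"
    and norms: "norm c0 \<le> 1" "norm c1 \<le> 1" "norm u \<le> 1" "norm v \<le> 1" and \<alpha>: "0 \<le> \<alpha>" "\<alpha> \<le> 1"
  shows "1/2 + gain \<alpha> B0 B1 c0 c1 u v / 8 \<le> pvm_bound \<alpha>"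
proof -
  obtain n0 where n0: "\<And>r. bias B0 r = n0 \<bullet> r"
    "n0 = 0 \<or> norm n0 = 1 \<and> (\<forall>r. bloch_map B0 r = (n0 \<bullet> r) *\<^sub>R bloch_map B0 n0)"
    using pvm_instrument_form[OF B0] by blast
  obtain n1 where n1: "\<And>r. bias B1 r = n1 \<bullet> r"
    "n1 = 0 \<or> norm n1 = 1 \<and> (\<forall>r. bloch_map B1 r = (n1 \<bullet> r) *\<^sub>R bloch_map B1 n1)"
    using pvm_instrument_form[OF B1] by blast
  note lin = linear_bloch_map[OF B0(1)] linear_bloch_map[OF B1(1)]
  note contr = bloch_map_contraction[OF B0(1)] bloch_map_contraction[OF B1(1)]
  have s: "norm (bloch_map B0 n0) \<le> 1" "norm (bloch_map B1 n1) \<le> 1"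
  proof -
    have "n0 = 0 \<or> norm n0 = 1" "n1 = 0 \<or> norm n1 = 1" using n0(2) n1(2) by blast+
    then have "norm n0 \<le> 1" "norm n1 \<le> 1" by auto
    then show "norm (bloch_map B0 n0) \<le> 1" "norm (bloch_map B1 n1) \<le> 1"
      using contr(1)[of n0] contr(2)[of n1] by linarith+
  qed
  have unit: "n \<noteq> 0" if "norm n = 1" for n :: "real^3" using that by auto
  obtain u' v' where uv: "norm u' = 1" "norm v' = 1"
    and le: "gain \<alpha> B0 B1 c0 c1 u v \<le> gain \<alpha> B0 B1 c0 c1 u' v'"
    using gain_le_sphere[OF B0(1) B1(1) norms(3,4)] by blast
  have orth: "(u' + v') \<bullet> (u' - v') = 0"
    using uv unfolding norm_eq_1 by (simp add: inner_add inner_diff inner_commute)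
  have par: "(norm (u' + v'))\<^sup>2 + (norm (u' - v'))\<^sup>2 = 4" using uv by (simp add: parallelogram)
  consider "n0 = 0" "n1 = 0" | "n0 = 0" "norm n1 = 1" | "norm n0 = 1" "n1 = 0" | "norm n0 = 1" "norm n1 = 1"
    using n0(2) n1(2) by blast
  then have "1/2 + gain \<alpha> B0 B1 c0 c1 u' v' / 8 \<le> pvm_bound \<alpha>"
  proof cases
    case 1
    have "gain \<alpha> B0 B1 c0 c1 u' v' \<le> 2 * sqrt 2 * (1 - \<alpha>)"
      using two_trivial_bound[OF _ _ _ norms(1,2) contr, of u' v' "1 - \<alpha>"] uv \<alpha> 1
      by (simp add: gain_def n0(1) n1(1))
    then show ?thesis using pvm_bound_max(1)[OF \<alpha>] by linarith
  next
    case 2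
    have f: "bloch_map B1 r = (n1 \<bullet> r) *\<^sub>R bloch_map B1 n1" for r
      using n1(2) unit[OF 2(2)] by blast
    have "gain \<alpha> B0 B1 c0 c1 u' v' \<le> sqrt (4 + (1 - \<alpha>)\<^sup>2)"
      using one_trivial_bound[OF lin(1) contr(1) orth par 2(2) s(2) norms(1,2) \<alpha>] 2(1)
      by (simp add: gain_def n0(1) n1(1) f[of "u' + v'"] f[of "u' - v'"])
    then show ?thesis using pvm_bound_max(2)[OF \<alpha>] by linarith
  next
    case 3
    have f: "bloch_map B0 r = (n0 \<bullet> r) *\<^sub>R bloch_map B0 n0" for r
      using n0(2) unit[OF 3(1)] by blast
    \<comment> \<open>Exchanging \<open>u' + v'\<close> with \<open>u' - v'\<close> and
      \<open>c0\<close> with \<open>c1\<close> exchanges the roles of the two instruments.\<close>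
    have orth': "(u' - v') \<bullet> (u' + v') = 0" using orth by (simp add: inner_commute)
    have par': "(norm (u' - v'))\<^sup>2 + (norm (u' + v'))\<^sup>2 = 4" using par by simp
    have "gain \<alpha> B0 B1 c0 c1 u' v' \<le> sqrt (4 + (1 - \<alpha>)\<^sup>2)"
      using one_trivial_bound[OF lin(2) contr(2) orth' par' 3(1) s(1) norms(2,1) \<alpha>] 3(2)
      by (simp add: gain_def n0(1) n1(1) f[of "u' + v'"] f[of "u' - v'"] add.commute)
    then show ?thesis using pvm_bound_max(2)[OF \<alpha>] by linarith
  next
    case 4
    have f: "bloch_map B0 r = (n0 \<bullet> r) *\<^sub>R bloch_map B0 n0"
      "bloch_map B1 r = (n1 \<bullet> r) *\<^sub>R bloch_map B1 n1" for r
      using n0(2) n1(2) unit[OF 4(1)] unit[OF 4(2)] by blast+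
    have "gain \<alpha> B0 B1 c0 c1 u' v' \<le> 2 * sqrt (1 + \<alpha>\<^sup>2)"
      using no_trivial_bound[OF _ _ 4 s norms(1,2) \<alpha>, of u' v'] uv
      by (simp add: gain_def n0(1) n1(1) f[of "u' + v'"] f[of "u' - v'"])
    then show ?thesis using pvm_bound_max(3)[OF \<alpha>] by linarith
  qed
  then show ?thesis using le by simp
qed

section \<open>Mixtures of instruments\<close>

lemma mixture_bias_bloch_map:
  fixes I :: "nat \<Rightarrow> bool \<Rightarrow> qop \<Rightarrow> qop"
  assumes "\<And>b X. B b X = (\<Sum>k<n. w k *\<^sub>R I k b X)"
  shows "bias B r = (\<Sum>k<n. w k * bias (I k) r)"
    and "bloch_map B r = (\<Sum>k<n. w k *\<^sub>R bloch_map (I k) r)"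
proof -
  show "bias B r = (\<Sum>k<n. w k * bias (I k) r)"
    unfolding bias_def assms linear_sum[OF linear_Re_trace] linear_scale[OF linear_Re_trace] by simp
  have "B False (pauli 0 r) + B True (pauli 0 r)
      = (\<Sum>k<n. w k *\<^sub>R (I k False (pauli 0 r) + I k True (pauli 0 r)))"
    unfolding assms by (simp add: sum.distrib scaleR_add_right)
  then show "bloch_map B r = (\<Sum>k<n. w k *\<^sub>R bloch_map (I k) r)"
    unfolding bloch_map_def by (simp add: linear_sum[OF linear_bloch] linear_scale[OF linear_bloch])
qed

lemma gain_mixture_left:
  fixes I :: "nat \<Rightarrow> bool \<Rightarrow> qop \<Rightarrow> qop"
  assumes "\<And>b X. B b X = (\<Sum>k<n. w k *\<^sub>R I k b X)" "(\<Sum>k<n. w k) = 1"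
  shows "gain \<alpha> B B1 c0 c1 u v = (\<Sum>k<n. w k * gain \<alpha> (I k) B1 c0 c1 u v)"
proof -
  \<comment> \<open>The gain is affine in the mixed instrument; the terms of the other one are
    constant and are spread over the weights.\<close>
  have one: "x = (\<Sum>k<n. w k * x)" for x :: real using assms(2) by (simp flip: sum_distrib_right)
  have "(\<Sum>k<n. w k * gain \<alpha> (I k) B1 c0 c1 u v) =
    \<alpha> * ((\<Sum>k<n. w k * bias (I k) (u + v)) + (\<Sum>k<n. w k * bias B1 (u - v))) + (1 - \<alpha>) / 2 *
    ((\<Sum>k<n. w k * (c0 \<bullet> bloch_map (I k) (u + v))) + (\<Sum>k<n. w k * (c0 \<bullet> bloch_map B1 (u + v)))
      + ((\<Sum>k<n. w k * (c1 \<bullet> bloch_map (I k) (u - v))) + (\<Sum>k<n. w k * (c1 \<bullet> bloch_map B1 (u - v)))))"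
    unfolding sum_distrib_left sum.distrib[symmetric]
    by (rule sum.cong) (simp_all add: gain_def inner_add_right algebra_simps)
  then show ?thesis
    by (simp add: gain_def mixture_bias_bloch_map[OF assms(1)] inner_add_right inner_sum_right
        flip: one)
qed

lemma gain_mixture_right:
  fixes I :: "nat \<Rightarrow> bool \<Rightarrow> qop \<Rightarrow> qop"
  assumes "\<And>b X. B b X = (\<Sum>k<n. w k *\<^sub>R I k b X)" "(\<Sum>k<n. w k) = 1"
  shows "gain \<alpha> B0 B c0 c1 u v = (\<Sum>k<n. w k * gain \<alpha> B0 (I k) c0 c1 u v)"
proof -
  \<comment> \<open>Replacing \<open>v\<close> by \<open>- v\<close> exchanges \<open>u + v\<close>
    with \<open>u - v\<close>, hence the two instruments.\<close>
  have swap: "gain \<alpha> B0 B' c0 c1 u v = gain \<alpha> B' B0 c1 c0 u (- v)" for B'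
    by (simp add: gain_def algebra_simps)
  show ?thesis unfolding swap by (rule gain_mixture_left[OF assms])
qed

lemma gain_projective_mixture_le:
  assumes B: "projective_mixture B0" "projective_mixture B1"
    and norms: "norm c0 \<le> 1" "norm c1 \<le> 1" "norm u \<le> 1" "norm v \<le> 1" and \<alpha>: "0 \<le> \<alpha>" "\<alpha> \<le> 1"
  shows "1/2 + gain \<alpha> B0 B1 c0 c1 u v / 8 \<le> pvm_bound \<alpha>"
proof -
  \<comment> \<open>The bound restated for the gain itself, so that it passes to weighted averages,
    first over the parts of \<open>B0\<close>, then of \<open>B1\<close>.\<close>
  define K where "K = 8 * (pvm_bound \<alpha> - 1/2)"
  have K: "gain \<alpha> B B' c0 c1 u v \<le> K \<longleftrightarrow> 1/2 + gain \<alpha> B B' c0 c1 u v / 8 \<le> pvm_bound \<alpha>" for B B'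
    by (auto simp: K_def field_simps)
  have mix: "(\<Sum>k<n. w k * f k) \<le> K"
    if "\<forall>k<n. 0 \<le> w k" "(\<Sum>k<n. w k) = 1" "\<And>k. k < n \<Longrightarrow> f k \<le> K" for n :: nat and w f
  proof -
    have "(\<Sum>k<n. w k * f k) \<le> (\<Sum>k<n. w k * K)"
      using that by (intro sum_mono mult_left_mono) auto
    then show ?thesis using that(2) by (simp flip: sum_distrib_right)
  qed
  obtain n :: nat and w I where 0: "\<forall>k<n. 0 \<le> w k" "(\<Sum>k<n. w k) = 1"
    "\<forall>k<n. instrument (I k) \<and> (\<exists>E. pvm E \<and> compatible (I k) E)"
    "\<forall>b X. B0 b X = (\<Sum>k<n. w k *\<^sub>R I k b X)"
    using B(1) unfolding projective_mixture_def by blast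
  obtain n' :: nat and w' I' where 1: "\<forall>k<n'. 0 \<le> w' k" "(\<Sum>k<n'. w' k) = 1"
    "\<forall>k<n'. instrument (I' k) \<and> (\<exists>E. pvm E \<and> compatible (I' k) E)"
    "\<forall>b X. B1 b X = (\<Sum>k<n'. w' k *\<^sub>R I' k b X)"
    using B(2) unfolding projective_mixture_def by blast
  have "gain \<alpha> B0 B1 c0 c1 u v \<le> K"
    unfolding gain_mixture_left[OF 0(4)[rule_format] 0(2)]
      gain_mixture_right[OF 1(4)[rule_format] 1(2)]
    by (intro mix 0(1,2) 1(1,2)) (use 0(3) 1(3) gain_pvm_le[OF _ _ _ _ _ _ norms \<alpha>] K in blast)
  then show ?thesis by (simp only: K)
qed

section \<open>From the game to the gain\<close>

lemma UNIV_bool_fun: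
  "(UNIV :: (bool \<Rightarrow> bool) set) = {\<lambda>_. False, \<lambda>_. True, \<lambda>b. b, \<lambda>b. \<not> b}"
proof -
  have "f = (\<lambda>_. False) \<or> f = (\<lambda>_. True) \<or> f = (\<lambda>b. b) \<or> f = (\<lambda>b. \<not> b)" for f :: "bool \<Rightarrow> bool"
    by (cases "f False"; cases "f True") (auto simp: fun_eq_iff all_bool_eq)
  then show ?thesis by blast
qed

lemma sum_bool_fun:
  fixes g :: "(bool \<Rightarrow> bool) \<Rightarrow> real"
  shows "(\<Sum>x\<in>UNIV. g x) = g (\<lambda>_. False) + g (\<lambda>_. True) + g (\<lambda>b. b) + g (\<lambda>b. \<not> b)"
  unfolding UNIV_bool_fun by (subst sum.insert; auto simp: fun_eq_iff all_bool_eq)+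

text \<open>With the probability of outcome \<open>True\<close> written as one minus that of
  \<open>False\<close>, the constants add up to 1/2. What remains are signed sums over Alice's
  inputs, which by linearity are values at \<open>pauli 0 (u + v)\<close> and
  \<open>pauli 0 (u - v)\<close>.\<close>

lemma avg_success_pure:
  assumes "valid_strategy S"
  obtains c0 c1 u v where "norm c0 \<le> 1" "norm c1 \<le> 1" "norm u \<le> 1" "norm v \<le> 1"
    "avg_success \<alpha> (pure_behaviour S) =
      1/2 + gain \<alpha> (instr S False) (instr S True) c0 c1 u v / 8"
proof -
  have inst: "instrument (instr S y)" and dens: "density (prep S x)" and povm: "povm (meas S z)" for x y z
    using assms by (auto simp: valid_strategy_def)
  have "\<exists>r. prep S x = pauli (1/2) ((1/2) *\<^sub>R r) \<and> norm r \<le> 1" for x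
    using dens[of x] density_pauli by blast
  then obtain a where a: "\<And>x. prep S x = pauli (1/2) ((1/2) *\<^sub>R a x)" "\<And>x. norm (a x) \<le> 1"
    by metis
  have "\<exists>m c. meas S z False = pauli m ((1/2) *\<^sub>R c) \<and> meas S z True = mat 1 - meas S z False
      \<and> norm c \<le> 1" for z
    using povm[of z] povm_pauli by blast
  then obtain m c where c: "\<And>z. meas S z False = pauli (m z) ((1/2) *\<^sub>R c z)"
    "\<And>z. meas S z True = mat 1 - meas S z False" "\<And>z. norm (c z) \<le> 1"
    by metis
  define u v where "u = (1/2) *\<^sub>R (a (\<lambda>_. False) - a (\<lambda>_. True))"
    and "v = (1/2) *\<^sub>R (a (\<lambda>b. b) - a (\<lambda>b. \<not> b))"
  have half: "norm ((1/2) *\<^sub>R (a x - a x')) \<le> 1" for x x'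
    using norm_triangle_ineq4[of "a x" "a x'"] a(2)[of x] a(2)[of x'] by simp
  define \<Phi> where "\<Phi> y = (\<lambda>X. instr S y False X + instr S y True X)" for y
  \<comment> \<open>\<open>H\<close> and \<open>K\<close> are the probabilities of output 0 for Bob
    and for Charlie, the latter given Bob's input \<open>y\<close>.\<close>
  define H where "H y x = Re (trace (instr S y False (prep S x)))" for y x
  define K where "K y z x = Re (trace (\<Phi> y (prep S x) ** meas S z False))" for y z x
  have lin\<Phi>: "linear (\<Phi> y)" and tr\<Phi>: "trace (\<Phi> y X) = trace X" and pos\<Phi>: "positive_map (\<Phi> y)" for y X
    using instrument_positive_map[OF inst[of y]] unfolding positive_map_def by (auto simp: \<Phi>_def)
  have tr1: "trace (prep S x) = 1" for x using dens by (simp add: density_def)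
  have bob: "prob_bob (pure_behaviour S) b x y = (if b then 1 - H y x else H y x)" for b x y
  proof -
    have "trace (instr S y False (prep S x)) + trace (instr S y True (prep S x)) = 1"
      using tr\<Phi>[of y "prep S x"] tr1 by (simp add: \<Phi>_def trace_add)
    then have "Re (trace (instr S y False (prep S x))) + Re (trace (instr S y True (prep S x))) = 1"
      by (metis plus_complex.simps(1) one_complex.simps(1))
    then show ?thesis unfolding prob_bob_def pure_bob_marginal[OF assms] by (auto simp: H_def)
  qed
  have charlie: "prob_charlie (pure_behaviour S) d x z =
      1/2 * (\<Sum>y\<in>UNIV. if d then 1 - K y z x else K y z x)" for d x z
  proof -
    have "(\<Sum>b\<in>UNIV. pure_behaviour S b d x y z) = Re (trace (\<Phi> y (prep S x) ** meas S z d))" for y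
      by (simp add: pure_behaviour_def UNIV_bool \<Phi>_def linear_add[OF linear_trace_mult])
    moreover have "Re (trace (\<Phi> y (prep S x) ** meas S z True)) = 1 - K y z x" for y
    proof -
      have "trace (X ** (mat 1 - C)) = trace X - trace (X ** C)" for X C :: qop
        by (simp add: trace_def matrix_matrix_mult_def sum_2 mat_def algebra_simps)
      then show ?thesis by (simp add: c(2) K_def tr\<Phi> tr1)
    qed
    ultimately show ?thesis by (cases d) (simp_all add: prob_charlie_def K_def)
  qed
  \<comment> \<open>An input has sign plus exactly when the bit to be guessed is 0: the first bit in
    \<open>diff1\<close>, the second in \<open>diff2\<close>.\<close>
  have diff1: "prep S (\<lambda>_. False) - prep S (\<lambda>_. True) + (prep S (\<lambda>b. b) - prep S (\<lambda>b. \<not> b)) = pauli 0 (u + v)"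
    and diff2: "prep S (\<lambda>_. False) - prep S (\<lambda>_. True) - (prep S (\<lambda>b. b) - prep S (\<lambda>b. \<not> b)) = pauli 0 (u - v)"
    unfolding a(1) pauli_diff pauli_add by (simp_all add: u_def v_def scaleR_diff_right)
  have H: "H y (\<lambda>_. False) - H y (\<lambda>_. True) + (H y (\<lambda>b. b) - H y (\<lambda>b. \<not> b)) = bias (instr S y) (u + v)"
    "H y (\<lambda>_. False) - H y (\<lambda>_. True) - (H y (\<lambda>b. b) - H y (\<lambda>b. \<not> b)) = bias (instr S y) (u - v)" for y
  proof -
    have lin: "linear (\<lambda>X. Re (trace (instr S y False X)))"
      by (rule linearI) (simp_all add: linear_add[OF instrument_linear[OF inst]]
          linear_scale[OF instrument_linear[OF inst]] linear_add[OF linear_trace]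
          linear_scale[OF linear_trace])
    show "H y (\<lambda>_. False) - H y (\<lambda>_. True) + (H y (\<lambda>b. b) - H y (\<lambda>b. \<not> b)) = bias (instr S y) (u + v)"
      "H y (\<lambda>_. False) - H y (\<lambda>_. True) - (H y (\<lambda>b. b) - H y (\<lambda>b. \<not> b)) = bias (instr S y) (u - v)"
      unfolding H_def bias_def diff1[symmetric] diff2[symmetric] linear_add[OF lin] linear_diff[OF lin] by simp_all
  qed
  have K: "K y z (\<lambda>_. False) - K y z (\<lambda>_. True) + (K y z (\<lambda>b. b) - K y z (\<lambda>b. \<not> b)) = c z \<bullet> bloch_map (instr S y) (u + v)"
    "K y z (\<lambda>_. False) - K y z (\<lambda>_. True) - (K y z (\<lambda>b. b) - K y z (\<lambda>b. \<not> b)) = c z \<bullet> bloch_map (instr S y) (u - v)" for y z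
  proof -
    have lin: "linear (\<lambda>X. Re (trace (\<Phi> y X ** meas S z False)))"
      by (rule linearI) (simp_all add: linear_add[OF lin\<Phi>] linear_scale[OF lin\<Phi>]
          linear_add[OF linear_trace_mult] linear_scale[OF linear_trace_mult])
    have "\<Phi> y (pauli 0 r) = pauli 0 (bloch_map (instr S y) r)" for r
    proof -
      have "bloch_map (instr S y) r = bloch (\<Phi> y (pauli 0 r))" by (simp add: bloch_map_def \<Phi>_def)
      then show ?thesis using positive_map_pauli[OF pos\<Phi>, of y 0 r] by (simp add: tr\<Phi>)
    qed
    then have val: "Re (trace (\<Phi> y (pauli 0 r) ** meas S z False)) = c z \<bullet> bloch_map (instr S y) r" for r
      by (simp add: c(1) trace_pauli_mult inner_commute)
    show "K y z (\<lambda>_. False) - K y z (\<lambda>_. True) + (K y z (\<lambda>b. b) - K y z (\<lambda>b. \<not> b)) = c z \<bullet> bloch_map (instr S y) (u + v)"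
      "K y z (\<lambda>_. False) - K y z (\<lambda>_. True) - (K y z (\<lambda>b. b) - K y z (\<lambda>b. \<not> b)) = c z \<bullet> bloch_map (instr S y) (u - v)"
      unfolding K_def val[symmetric] diff1[symmetric] diff2[symmetric] linear_add[OF lin] linear_diff[OF lin] by simp_all
  qed
  have "avg_success \<alpha> (pure_behaviour S) =
      1/2 + gain \<alpha> (instr S False) (instr S True) (c False) (c True) u v / 8"
    unfolding gain_def inner_add_right H[symmetric] K[symmetric]
    by (simp add: avg_success_def sum_bool_fun UNIV_bool bob charlie field_simps)
  then show ?thesis using that c(3) half unfolding u_def v_def by blast
qed

text \<open>The success probability is a finite linear combination of the probabilities in the
  behaviour, so it commutes with the average over the shared randomness.\<close>

lemma avg_success_behaviour_of:
  assumes "shared_randomness_strategy M S"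
  shows "integrable M (\<lambda>r. avg_success \<alpha> (pure_behaviour (S r)))"
    and "avg_success \<alpha> (behaviour_of M S) = (\<integral>r. avg_success \<alpha> (pure_behaviour (S r)) \<partial>M)"
  using integrable_pure_behaviour[OF assms]
  by (simp_all add: avg_success_def prob_bob_def prob_charlie_def behaviour_of_def)

theorem proposition1:
  fixes \<alpha> :: real and M :: "'r measure" and S :: "'r \<Rightarrow> strategy"
  assumes "0 \<le> \<alpha>" and "\<alpha> \<le> 1"
    and "shared_randomness_strategy M S"
    and "\<And>r y. r \<in> space M \<Longrightarrow> projective_mixture (instr (S r) y)"
  shows "avg_success \<alpha> (behaviour_of M S) \<le> pvm_bound \<alpha>"
proof -
  interpret prob_space M using assms(3) by (simp add: shared_randomness_strategy_def)
  have "avg_success \<alpha> (pure_behaviour (S r)) \<le> pvm_bound \<alpha>" if "r \<in> space M" for r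
  proof -
    have "valid_strategy (S r)" using assms(3) that by (simp add: shared_randomness_strategy_def)
    then show ?thesis
      using gain_projective_mixture_le[OF assms(4,4)[OF that] _ _ _ _ assms(1,2)]
      by (elim avg_success_pure[where \<alpha> = \<alpha>]) simp
  qed
  then have "(\<integral>r. avg_success \<alpha> (pure_behaviour (S r)) \<partial>M) \<le> (\<integral>r. pvm_bound \<alpha> \<partial>M)"
    by (intro integral_mono avg_success_behaviour_of(1)[OF assms(3)]) auto
  then show ?thesis by (simp add: avg_success_behaviour_of(2)[OF assms(3)] prob_space)
qed

end
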